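(* Let $G$ be a bipartite graph and let $\mathcal R_{\widehat G}$ be the root polytope of its augmented bipartite graph $\widehat G$. Then the normalized volume of $\mathcal R_{\widehat G}$ is $$\operatorname{NVol}(\mathcal R_{\widehat G})=F_G(1)=|D(G)|.$$
   Context: $G=(L\sqcup R,E)$ is a bipartite graph with left vertices $\ell_1,\dots,\ell_m$ and right vertices $r_1,\dots,r_n$; $I_j=\{i\in[n]\mid \ell_j \text{ is adjacent to } r_i\}$ for $j\in[m]$. A $G$-draconian sequence is a sequence $(a_1,\dots,a_m)$ of nonnegative integers such that $\sum_{i\in J}a_i\le|\bigcup_{i\in J}I_i|$ for every nonempty $J\subset[m]$; $D(G)$ is the set of all of them. $F_G(z)=\sum_{\boldsymbol a\in D(G)}z^{s(\boldsymbol a)}$, where $s(\boldsymbol a)$ is the number of positive coordinates of $\boldsymbol a$. The augmented bipartite graph $\widehat G$ is obtained from $G$ by adding a new left vertex $\ell_0$ and a new right vertex $r_0$, making $\ell_0$ adjacent to every right vertex $r_0,r_1,\dots,r_n$ and $r_0$ adjacent to every left vertex $\ell_0,\ell_1,\dots,\ell_m$; the edges of $G$ are kept. The root polytope of $\widehat G$ is $\mathcal R_{\widehat G}=\operatorname{conv}(\boldsymbol e_i+\boldsymbol f_j\mid(\ell_i,r_j)\text{ an edge of }\widehat G)\subset\mathbb R^{m+1}\oplus\mathbb R^{n+1}$, where $\boldsymbol e_0,\dots,\boldsymbol e_m$ and $\boldsymbol f_0,\dots,\boldsymbol f_n$ are the standard bases. For a lattice polytope $P$, $\operatorname{Vol}(P)$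 is the volume of $P$ with respect to the lattice of integer points in the affine span $\operatorname{aff}(P)$ (a fundamental parallelepiped of that lattice has volume 1), and $\operatorname{NVol}(P)=\dim(P)!\operatorname{Vol}(P)$. *)

theory Defs
  imports
    "HOL-Analysis.Analysis"
    "HOL-Computational_Algebra.Polynomial"
begin

text \<open>
  A bipartite graph with left vertices indexed by a finite type \<open>'m\<close> and right vertices indexed
  by a finite type \<open>'n\<close> is given by its set of edges, oriented from left to right.
\<close>

type_synonym ('m, 'n) bigraph = "('m \<times> 'n) set"

definition nbrs :: "('m::finite, 'n::finite) bigraph \<Rightarrow> 'm \<Rightarrow> 'n set" where
  "nbrs G j = {i. (j, i) \<in> G}"

definition draconian :: "('m::finite, 'n::finite) bigraph \<Rightarrow> ('m \<Rightarrow> nat) set" where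
  "draconian G =
     {a. \<forall>J. J \<noteq> {} \<longrightarrow> (\<Sum>i\<in>J. a i) \<le> card (\<Union>i\<in>J. nbrs G i)}"

lemma finite_draconian: "finite (draconian G)"
  for G :: "('m::finite, 'n::finite) bigraph"
proof (rule finite_subset)
  show "draconian G \<subseteq> Pi\<^sub>E UNIV (\<lambda>_. {..CARD('n)})"
  proof
    fix a assume a: "a \<in> draconian G"
    have "a i \<le> CARD('n)" for i
    proof -
      have "(\<Sum>i\<in>{i}. a i) \<le> card (\<Union>i\<in>{i}. nbrs G i)"
        using a unfolding draconian_def by blast
      also have "\<dots> \<le> CARD('n)"
        by (simp add: card_mono)
      finally show ?thesis by simp
    qed
    then show "a \<in> Pi\<^sub>E UNIV (\<lambda>_. {..CARD('n)})"
      by (simp add: PiE_UNIV_domain)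
  qed
  show "finite (Pi\<^sub>E (UNIV :: 'm set) (\<lambda>_. {..CARD('n)}))"
    by (intro finite_PiE) auto
qed

definition draconian_poly :: "('m::finite, 'n::finite) bigraph \<Rightarrow> int poly" where
  "draconian_poly G = (\<Sum>a\<in>draconian G. monom 1 (card {i. a i > 0}))"

text \<open>The added vertices are \<open>None\<close> on either side; \<open>Some\<close> embeds the old ones.\<close>

definition augmented :: "('m::finite, 'n::finite) bigraph \<Rightarrow> ('m option, 'n option) bigraph" where
  "augmented G =
     {None} \<times> UNIV \<union> UNIV \<times> {None} \<union> {(Some l, Some r) | l r. (l, r) \<in> G}"

text \<open>
  The direct sum of the two coordinate spaces is the product type, so that
  \<open>e\<^sub>i + f\<^sub>j\<close> is the pair \<open>(axis i 1, axis j 1)\<close>.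
\<close>

definition root_polytope :: "('m::finite, 'n::finite) bigraph \<Rightarrow> ((real ^ 'm) \<times> (real ^ 'n)) set" where
  "root_polytope G = convex hull {(axis i 1, axis j 1) | i j. (i, j) \<in> G}"

definition integer_points :: "'a::euclidean_space set" where
  "integer_points = {x. \<forall>b\<in>Basis. x \<bullet> b \<in> \<int>}"

text \<open>
  \<open>p\<close> together with \<open>b\<^sub>0, \<dots>, b\<^bsub>d-1\<^esub>\<close> is an affine lattice basis of the lattice of
  integer points in the affine span of \<open>P\<close>, where \<open>d = dim P\<close>.
\<close>

definition lattice_frame :: "'a::euclidean_space set \<Rightarrow> 'a \<Rightarrow> (nat \<Rightarrow> 'a) \<Rightarrow> bool" where
  "lattice_frame P p b \<longleftrightarrow>
     (let d = nat (aff_dim P) in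
        inj_on b {..<d} \<and> independent (b ` {..<d}) \<and>
        range (\<lambda>c :: nat \<Rightarrow> int. p + (\<Sum>i<d. of_int (c i) *\<^sub>R b i))
          = affine hull P \<inter> integer_points)"

text \<open>
  Volume with respect to the lattice of integer points in the affine span: the \<open>d\<close>-dimensional
  Lebesgue measure of \<open>P\<close> in the coordinates of any affine lattice basis, so that the fundamental
  parallelepiped has volume 1. Two such bases differ by a unimodular integral affine map,
  so for a lattice polytope the value does not depend on the choice.
\<close>

definition lattice_volume :: "'a::euclidean_space set \<Rightarrow> real" where
  "lattice_volume P =
     (let d = nat (aff_dim P) in
        THE v. \<exists>p b. lattice_frame P p b \<and>
          v = measure (\<Pi>\<^sub>M i\<in>{..<d}. lborel :: real measure)
                {t \<in> Pi\<^sub>E {..<d} (\<lambda>_. UNIV). p + (\<Sum>i<d. t i *\<^sub>R b i) \<in> P})"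

definition normalized_volume :: "'a::euclidean_space set \<Rightarrow> real" where
  "normalized_volume P = fact (nat (aff_dim P)) * lattice_volume P"

end

theory Submission imports Defs begin

text \<open>
  Triangulate the root polytope by a regular triangulation. Affinely independent sets of vertices
  correspond to forests, and the vertices of a full-dimensional cell, a spanning tree, generate the
  lattice because the coefficient of an edge is the difference of the coordinate sums on one side
  of its fundamental cut. Hence every full cell has normalized volume 1, in any lattice frame, and
  the normalized volume is the number of full cells.

  Send a full cell to the sequence \<open>a\<close> of left degrees minus one. It is draconian because a forest
  on \<open>k\<close> vertices has fewer than \<open>k\<close> edges. Let \<open>M\<close> be the number of left vertices. The multiple of
  the point with left coordinates \<open>a\<^sub>i + 1 / M\<close> and right coordinates 1 that lies in the polytope is
  interior to a full cell precisely when the cell has left degrees \<open>a\<^sub>i + 1\<close>, so the map is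
  injective; it is onto because a Hall type argument places this point in the polytope for every
  draconian sequence.
\<close>

section \<open>Regular triangulations\<close>

text \<open>\<open>lattice_volume\<close> is a definite description over all lattice frames, so the
  volume has to be computed in an arbitrary frame, and some frame has to be exhibited; the vertices
  of one full cell supply it. Besides affine independence of the cells, the triangulation is used
  through a single property: each point of the polytope lies in the relative interior of exactly one
  cell. This property gives both additivity of the volume and the bijection with draconian
  sequences.

  The two added vertices are what makes the bijection work. The added right vertex absorbs the
  surplus 1 / M of every left vertex. The added left vertex serves the right vertices that an
  assignment leaves free, so its own coordinate is forced to be n minus the sum of the others; this
  is why sequences indexed by the old left vertices determine all degrees of a spanning
  tree.\<close>

text \<open>A point of the moment curve avoids finitely many hyperplanes: along the heights
  \<open>t ^ h v\<close> each linear form \<open>z\<close> becomes a nonzero polynomial in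
  \<open>t\<close>, which has finitely many roots.\<close>

lemma generic_heights:
  fixes Z :: "('v \<Rightarrow> real) set"
  assumes V: "finite V" and Z: "finite Z" and nz: "\<And>z. z \<in> Z \<Longrightarrow> \<exists>v\<in>V. z v \<noteq> 0"
  obtains c :: "'v \<Rightarrow> real" where "\<And>z. z \<in> Z \<Longrightarrow> (\<Sum>v\<in>V. z v * c v) \<noteq> 0"
proof -
  obtain h :: "'v \<Rightarrow> nat" where h: "inj_on h V"
    using finite_imp_inj_to_nat_seg[OF V] by blast
  define p where "p z = (\<Sum>v\<in>V. monom (z v) (h v))" for z :: "'v \<Rightarrow> real"
  have "p z \<noteq> 0" if z: "z \<in> Z" for z
  proof -
    obtain v where v: "v \<in> V" "z v \<noteq> 0" using nz[OF z] by blast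
    have "coeff (p z) (h v) = (\<Sum>w\<in>V. if w = v then z w else 0)"
      unfolding p_def coeff_sum coeff_monom
      by (intro sum.cong refl) (use h v in \<open>auto simp: inj_on_def\<close>)
    also have "\<dots> = z v" using V v by simp
    finally show ?thesis using v by force
  qed
  then have "finite (\<Union>z\<in>Z. {t. poly (p z) t = 0})"
    using Z by (auto intro: poly_roots_finite)
  then obtain t where t: "t \<notin> (\<Union>z\<in>Z. {t. poly (p z) t = 0})"
    using ex_new_if_finite[OF infinite_UNIV_char_0] by blast
  have "poly (p z) t = (\<Sum>v\<in>V. z v * t ^ h v)" for z
    unfolding p_def poly_sum poly_monom ..
  with t show ?thesis by (intro that[of "\<lambda>v. t ^ h v"]) auto
qed

text \<open>
  Lift the points to generic heights. A cell is the support of a system of convex weights whose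
  height is minimal among all weights representing the same point. Minimality depends only on the
  support, and genericity of the heights makes the supports affinely independent.
\<close>

lemma regular_triangulation:
  fixes V :: "'a::euclidean_space set"
  assumes V: "finite V"
  obtains \<T> where "\<And>S. S \<in> \<T> \<Longrightarrow> S \<subseteq> V" "\<And>S. S \<in> \<T> \<Longrightarrow> \<not> affine_dependent S"
    "\<And>q. q \<in> convex hull V \<Longrightarrow> \<exists>!S. S \<in> \<T> \<and> q \<in> rel_interior (convex hull S)"
proof -
  define dp where "dp z \<longleftrightarrow> sum z V = 0 \<and> (\<Sum>v\<in>V. z v *\<^sub>R v) = 0 \<and> (\<exists>v\<in>V. z v \<noteq> 0)" for z :: "'a \<Rightarrow> real"
  have ex_dep: "\<exists>z. dp z \<and> (\<forall>v. v \<notin> S \<longrightarrow> z v = 0)" if S: "S \<subseteq> V" "affine_dependent S" for S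
  proof -
    have fS: "finite S" using S V finite_subset by blast
    obtain U v where U: "sum U S = 0" "v \<in> S" "U v \<noteq> 0" "(\<Sum>v\<in>S. U v *\<^sub>R v) = 0"
      using S affine_dependent_explicit_finite[OF fS] by blast
    define z where "z v = (if v \<in> S then U v else 0)" for v
    have "sum U S = sum z V" "(\<Sum>v\<in>S. U v *\<^sub>R v) = (\<Sum>v\<in>V. z v *\<^sub>R v)"
      by (rule sum.mono_neutral_cong_left; use S V in \<open>simp add: z_def\<close>)+
    then have "dp z" unfolding dp_def using U S by (auto simp: z_def)
    then show ?thesis by (auto simp: z_def intro!: exI[of _ z])
  qed
  then obtain \<zeta> where \<zeta>: "\<And>S. S \<subseteq> V \<Longrightarrow> affine_dependent S \<Longrightarrow> dp (\<zeta> S) \<and> (\<forall>v. v \<notin> S \<longrightarrow> \<zeta> S v = 0)"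
    by metis
  \<comment> \<open>One dependence per dependent subset suffices, which keeps the set that the
    heights must avoid finite.\<close>
  define Z where "Z = \<zeta> ` {S. S \<subseteq> V \<and> affine_dependent S}"
  have "finite Z" using V by (auto simp: Z_def)
  then obtain c where c: "\<And>z. z \<in> Z \<Longrightarrow> (\<Sum>v\<in>V. z v * c v) \<noteq> 0"
    by (rule generic_heights[OF V]) (use \<zeta> in \<open>auto simp: Z_def dp_def\<close>)
  define ht where "ht u = (\<Sum>v\<in>V. u v * c v)" for u
  define pt where "pt u = (\<Sum>v\<in>V. u v *\<^sub>R v)" for u
  define wt where "wt u \<longleftrightarrow> (\<forall>v\<in>V. 0 \<le> u v) \<and> sum u V = 1" for u :: "'a \<Rightarrow> real"
  define opt where "opt u \<longleftrightarrow> wt u \<and> (\<forall>w. wt w \<longrightarrow> pt w = pt u \<longrightarrow> ht u \<le> ht w)" for u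
  define sp where "sp u = {v \<in> V. u v > 0}" for u :: "'a \<Rightarrow> real"
  have room: "\<exists>e>0. \<forall>v\<in>V. 0 \<le> u v + e * z v"
    if u: "wt u" and z: "\<And>v. v \<in> V \<Longrightarrow> u v = 0 \<Longrightarrow> 0 \<le> z v" for u z
  proof -
    have "\<exists>e>0. 0 \<le> u v + e * z v" if "v \<in> V" for v
    proof (cases "0 \<le> z v")
      case True
      then show ?thesis using u that by (auto simp: wt_def intro!: exI[of _ 1])
    next
      case False
      then have "u v > 0" using z[OF that] u that by (force simp: wt_def)
      then show ?thesis using False
        by (intro exI[of _ "u v / (- z v)"]) (auto simp: field_simps)
    qed
    then obtain e where e: "\<And>v. v \<in> V \<Longrightarrow> e v > 0 \<and> 0 \<le> u v + e v * z v" by metis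
    define e0 where "e0 = Min (insert 1 (e ` V))"
    have pos: "e0 > 0" using V e by (auto simp: e0_def)
    have "0 \<le> u v + e0 * z v" if v: "v \<in> V" for v
    proof (cases "0 \<le> z v")
      case True
      then show ?thesis using u v pos by (auto simp: wt_def)
    next
      case False
      have "e0 \<le> e v" using V v by (auto simp: e0_def)
      then have "e0 * z v \<ge> e v * z v" using False by (intro mult_right_mono_neg) auto
      then show ?thesis using e[OF v] by linarith
    qed
    then show ?thesis using pos by blast
  qed
  \<comment> \<open>First-order optimality: a direction \<open>z\<close> that keeps the represented
    point and is nonnegative where \<open>u\<close> vanishes allows a small positive step, so it
    cannot lower the height.\<close>
  have shift: "ht z \<ge> 0" if u: "opt u" and z: "\<And>v. v \<in> V \<Longrightarrow> u v = 0 \<Longrightarrow> 0 \<le> z v"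
    "sum z V = 0" "pt z = 0" for u z
  proof -
    obtain e where e: "e > 0" "\<forall>v\<in>V. 0 \<le> u v + e * z v"
      using room[of u z] u z by (auto simp: opt_def)
    let ?w = "\<lambda>v. u v + e * z v"
    have "wt ?w" using e u z
      by (auto simp: wt_def opt_def sum.distrib sum_distrib_left[symmetric])
    moreover have "pt ?w = pt u + e *\<^sub>R pt z"
      by (simp add: pt_def sum.distrib scaleR_right.sum scaleR_add_left)
    moreover have "ht ?w = ht u + e * ht z"
      by (simp add: ht_def sum.distrib sum_distrib_left algebra_simps)
    ultimately have "ht u \<le> ht u + e * ht z" using u z by (auto simp: opt_def)
    then show ?thesis using e by (simp add: zero_le_mult_iff)
  qed
  \<comment> \<open>A dependence supported on \<open>sp u\<close> can be followed in both
    directions, so its height is 0, which the choice of \<open>c\<close> excludes.\<close>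
  have indep: "\<not> affine_dependent (sp u)" if u: "opt u" for u
  proof
    assume dep: "affine_dependent (sp u)"
    have sub: "sp u \<subseteq> V" by (auto simp: sp_def)
    let ?z = "\<zeta> (sp u)"
    have z: "dp ?z" "\<forall>v. v \<notin> sp u \<longrightarrow> ?z v = 0" using \<zeta>[OF sub dep] by auto
    have "ht ?z \<ge> 0" by (rule shift[OF u]) (use z in \<open>auto simp: dp_def sp_def pt_def\<close>)
    moreover have "ht (\<lambda>v. - ?z v) \<ge> 0"
      by (rule shift[OF u]) (use z in \<open>auto simp: dp_def sp_def pt_def sum_negf\<close>)
    ultimately have "ht ?z = 0" by (simp add: ht_def sum_negf)
    then show False using c[of ?z] sub dep by (auto simp: Z_def ht_def)
  qed
  \<comment> \<open>Where \<open>u\<close> vanishes, \<open>w\<close> vanishes too, so for every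
    competitor \<open>x\<close> the difference \<open>x - w\<close> is an admissible direction at
    \<open>u\<close>.\<close>
  have down: "opt w" if u: "opt u" and w: "wt w" "sp w \<subseteq> sp u" for u w
    unfolding opt_def
  proof (intro conjI allI impI)
    fix x assume x: "wt x" "pt x = pt w"
    have w0: "w v = 0" if "v \<in> V" "u v = 0" for v
      using that w by (force simp: wt_def sp_def)
    have "ht (\<lambda>v. x v - w v) \<ge> 0"
      by (rule shift[OF u]) (use x w w0 in \<open>auto simp: wt_def pt_def sum_subtractf scaleR_diff_left\<close>)
    then show "ht w \<le> ht x" by (simp add: ht_def sum_subtractf left_diff_distrib)
  qed (fact w)
  \<comment> \<open>The midpoint of two optima is optimal and its support contains both supports; a
    nonzero difference of the two would be an affine dependence on that support.\<close>
  have uniq: "w v = w' v" if w: "opt w" "opt w'" "pt w = pt w'" and v: "v \<in> V" for w w' v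
  proof (rule ccontr)
    assume ne: "w v \<noteq> w' v"
    define m where "m v = (w v + w' v) / 2" for v
    have wm: "wt m" using w
      by (auto simp: m_def wt_def opt_def sum_divide_distrib[symmetric] sum.distrib)
    have pm: "pt m = pt w"
    proof -
      have "pt m = (1/2) *\<^sub>R (pt w + pt w')"
        by (simp add: pt_def m_def sum.distrib scaleR_right.sum algebra_simps add_divide_distrib)
      then show ?thesis using w by (simp add: scaleR_2[symmetric])
    qed
    have hm: "ht m = (ht w + ht w') / 2"
      by (simp add: ht_def m_def sum.distrib[symmetric] sum_divide_distrib algebra_simps add_divide_distrib)
    have "ht w = ht w'" using w by (force simp: opt_def intro: antisym)
    then have "opt m" using w wm pm hm by (auto simp: opt_def)
    note im = indep[OF this]
    have fin: "finite (sp m)" using V by (auto simp: sp_def)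
    have out: "w x - w' x = 0" if "x \<in> V" "x \<notin> sp m" for x
    proof -
      have "0 \<le> w x" "0 \<le> w' x" using w that by (auto simp: opt_def wt_def)
      then show ?thesis using that by (auto simp: sp_def m_def)
    qed
    have 1: "(\<Sum>x\<in>sp m. w x - w' x) = (\<Sum>x\<in>V. w x - w' x)"
      by (intro sum.mono_neutral_left V) (use out in \<open>auto simp: sp_def\<close>)
    have 2: "(\<Sum>x\<in>sp m. (w x - w' x) *\<^sub>R x) = (\<Sum>x\<in>V. (w x - w' x) *\<^sub>R x)"
      by (intro sum.mono_neutral_left V) (use out in \<open>auto simp: sp_def\<close>)
    have "affine_dependent (sp m)"
      unfolding affine_dependent_explicit_finite[OF fin]
    proof (intro exI[of _ "\<lambda>x. w x - w' x"] conjI bexI[of _ v])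
      show "(\<Sum>x\<in>sp m. w x - w' x) = 0" "(\<Sum>x\<in>sp m. (w x - w' x) *\<^sub>R x) = 0"
        using 1 2 w by (simp_all add: opt_def wt_def pt_def sum_subtractf scaleR_diff_left)
    qed (use ne out[OF v] in auto)
    then show False using im by blast
  qed
  have exopt: "\<exists>u. opt u \<and> pt u = q" if q: "q \<in> convex hull V" for q
  proof -
    let ?f = "\<lambda>v. (v, c v)"
    \<comment> \<open>The fibre over \<open>q\<close> of the lifted polytope is compact, so the
      height attains its minimum on it.\<close>
    define K where "K = convex hull (?f ` V) \<inter> {q} \<times> UNIV"
    have hull: "x \<in> convex hull (?f ` V) \<longleftrightarrow> (\<exists>u. wt u \<and> x = (pt u, ht u))" for x
    proof -
      have inj: "inj_on ?f V" by (auto simp: inj_on_def)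
      have "x \<in> convex hull (?f ` V) \<longleftrightarrow>
        (\<exists>u. (\<forall>y\<in>V. 0 \<le> u (?f y)) \<and> (\<Sum>y\<in>V. u (?f y)) = 1 \<and> (\<Sum>y\<in>V. u (?f y) *\<^sub>R ?f y) = x)"
        using V by (auto simp: convex_hull_finite sum.reindex[OF inj])
      also have "\<dots> \<longleftrightarrow> (\<exists>u. (\<forall>y\<in>V. 0 \<le> u y) \<and> (\<Sum>y\<in>V. u y) = 1 \<and> (\<Sum>y\<in>V. u y *\<^sub>R ?f y) = x)"
        (is "(\<exists>u. ?P u) \<longleftrightarrow> (\<exists>u. ?Q u)")
      proof
        assume "\<exists>u. ?P u"
        then obtain u where "?P u" by blast
        then show "\<exists>u. ?Q u" by (intro exI[of _ "\<lambda>y. u (?f y)"])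
      next
        assume "\<exists>u. ?Q u"
        then obtain u where "?Q u" by blast
        then show "\<exists>u. ?P u" by (intro exI[of _ "\<lambda>z. u (fst z)"]) simp
      qed
      also have "\<dots> \<longleftrightarrow> (\<exists>u. wt u \<and> x = (pt u, ht u))"
        by (rule arg_cong[where f = Ex], rule ext) (auto simp: wt_def pt_def ht_def sum_prod)
      finally show ?thesis .
    qed
    have "compact K" unfolding K_def
      using V by (intro compact_Int_closed finite_imp_compact_convex_hull closed_Times) auto
    moreover have "K \<noteq> {}"
    proof -
      obtain u where "wt u" "pt u = q" using q V by (auto simp: convex_hull_finite wt_def pt_def)
      then have "(q, ht u) \<in> K" using hull by (auto simp: K_def)
      then show ?thesis by blast
    qed
    ultimately obtain x where x: "x \<in> K" "\<And>y. y \<in> K \<Longrightarrow> snd x \<le> snd y"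
      using continuous_attains_inf[of K snd] continuous_on_snd[OF continuous_on_id] by blast
    obtain u where u: "wt u" "x = (pt u, ht u)" "pt u = q" using x hull by (auto simp: K_def)
    have "opt u" unfolding opt_def
    proof (intro conjI allI impI)
      fix w assume "wt w" "pt w = pt u"
      then have "(pt w, ht w) \<in> K" using u hull by (auto simp: K_def)
      from x(2)[OF this] show "ht u \<le> ht w" using u by simp
    qed (fact u)
    then show ?thesis using u by blast
  qed
  define \<T> where "\<T> = sp ` {u. opt u}"
  have relint: "q \<in> rel_interior (convex hull S) \<longleftrightarrow> (\<exists>u. opt u \<and> sp u = S \<and> pt u = q)"
    if S: "S \<in> \<T>" for S q
  proof -
    obtain u0 where u0: "opt u0" "S = sp u0" using S by (auto simp: \<T>_def)
    have SV: "S \<subseteq> V" using u0 by (auto simp: sp_def)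
    have "q \<in> rel_interior (convex hull S) \<longleftrightarrow> (\<exists>u. (\<forall>x \<in> S. 0 < u x) \<and> sum u S = 1 \<and> sum (\<lambda>x. u x *\<^sub>R x) S = q)"
      using rel_interior_convex_hull_explicit[OF indep[OF u0(1)]] u0 by auto
    also have "\<dots> \<longleftrightarrow> (\<exists>u. opt u \<and> sp u = S \<and> pt u = q)"
    proof
      assume "\<exists>u. (\<forall>x \<in> S. 0 < u x) \<and> sum u S = 1 \<and> sum (\<lambda>x. u x *\<^sub>R x) S = q"
      then obtain u where u: "\<forall>x \<in> S. 0 < u x" "sum u S = 1" "sum (\<lambda>x. u x *\<^sub>R x) S = q" by blast
      define w where "w v = (if v \<in> S then u v else 0)" for v
      have "sum u S = sum w V" "(\<Sum>v\<in>S. u v *\<^sub>R v) = pt w"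
        unfolding pt_def by (rule sum.mono_neutral_cong_left; use SV V in \<open>simp add: w_def\<close>)+
      then have wt: "wt w" "pt w = q" using u by (auto simp: wt_def w_def less_imp_le)
      have "sp w = S" using SV u by (auto simp: sp_def w_def)
      then show "\<exists>u. opt u \<and> sp u = S \<and> pt u = q" using down[OF u0(1) wt(1)] u0 wt by auto
    next
      assume "\<exists>u. opt u \<and> sp u = S \<and> pt u = q"
      then obtain u where u: "opt u" "sp u = S" "pt u = q" by blast
      have z: "u v = 0" if "v \<in> V - S" for v using u that by (force simp: sp_def opt_def wt_def)
      have "sum u S = sum u V" "(\<Sum>v\<in>S. u v *\<^sub>R v) = pt u"
        using SV V z unfolding pt_def by (auto intro!: sum.mono_neutral_left)
      moreover have "\<forall>x\<in>S. 0 < u x" using u by (auto simp: sp_def)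
      ultimately show "\<exists>u. (\<forall>x \<in> S. 0 < u x) \<and> sum u S = 1 \<and> sum (\<lambda>x. u x *\<^sub>R x) S = q"
        using u by (auto simp: opt_def wt_def)
    qed
    finally show ?thesis .
  qed
  show ?thesis
  proof (rule that[of \<T>])
    fix q assume "q \<in> convex hull V"
    then obtain u where u: "opt u" "pt u = q" using exopt by blast
    show "\<exists>!S. S \<in> \<T> \<and> q \<in> rel_interior (convex hull S)"
    proof (rule ex1I[of _ "sp u"])
      show "sp u \<in> \<T> \<and> q \<in> rel_interior (convex hull (sp u))"
        using u relint[of "sp u" q] by (auto simp: \<T>_def)
    next
      fix S assume S: "S \<in> \<T> \<and> q \<in> rel_interior (convex hull S)"
      then obtain w where w: "opt w" "sp w = S" "pt w = q" using relint by blast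
      have "w v = u v" if "v \<in> V" for v using uniq w u that by simp
      then show "S = sp u" using w by (auto simp: sp_def)
    qed
  qed (use indep in \<open>auto simp: \<T>_def sp_def\<close>)
qed

section \<open>Volume in a lattice frame\<close>

text \<open>
  A well-ordered copy of a finite type: the change of variables formula for \<open>real ^ 'k\<close> needs a
  well-ordered index type, and the coordinates of a lattice frame are indexed by an initial
  segment of the natural numbers.
\<close>

typedef 'a index = "{..<CARD('a::finite)} :: nat set"
  by (auto intro: exI[of _ 0])

lemma bij_betw_Rep_index: "bij_betw (Rep_index :: 'a::finite index \<Rightarrow> nat) UNIV {..<CARD('a)}"
  using Rep_index[where ?'a = 'a]
  by (intro bij_betw_byWitness[where f' = Abs_index]) (auto simp: Rep_index_inverse Abs_index_inverse)

lemma Rep_index_less: "Rep_index (k :: 'a::finite index) < CARD('a)"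
  using Rep_index[of k] by simp

instance index :: (finite) finite
  using bij_betw_finite[OF bij_betw_Rep_index] by intro_classes simp

lemma card_index [simp]: "CARD('a index) = CARD('a::finite)"
  using bij_betw_same_card[OF bij_betw_Rep_index[where ?'a = 'a]] by simp

instantiation index :: (finite) wellorder
begin

definition less_eq_index :: "'a index \<Rightarrow> 'a index \<Rightarrow> bool" where
  "less_eq_index x y \<longleftrightarrow> Rep_index x \<le> Rep_index y"

definition less_index :: "'a index \<Rightarrow> 'a index \<Rightarrow> bool" where
  "less_index x y \<longleftrightarrow> Rep_index x < Rep_index y"

instance
proof
  fix P :: "'a index \<Rightarrow> bool" and a
  assume step: "\<And>x. (\<And>y. y < x \<Longrightarrow> P y) \<Longrightarrow> P x"
  show "P a"
  proof (induction a rule: measure_induct_rule[of Rep_index])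
    case (less x)
    show ?case by (rule step) (rule less.IH, simp add: less_index_def)
  qed
qed (auto simp: less_eq_index_def less_index_def Rep_index_inject)

end

lemma measurable_index_vec [measurable]:
  "(\<lambda>t. (\<chi> k. t (Rep_index k)) :: real ^ 'k::finite index) \<in> borel_measurable (\<Pi>\<^sub>M i\<in>{..<CARD('k)}. lborel)"
proof -
  let ?M = "\<Pi>\<^sub>M i\<in>{..<CARD('k)}. lborel :: real measure"
  have "(\<lambda>t. t (Rep_index (k :: 'k index))) \<in> ?M \<rightarrow>\<^sub>M lborel" for k
    by (rule measurable_component_singleton) (simp add: Rep_index_less)
  then have "(\<lambda>t. \<Sum>k\<in>UNIV. t (Rep_index k) *\<^sub>R (axis k 1 :: real ^ 'k index)) \<in> borel_measurable ?M"
    by (intro borel_measurable_sum borel_measurable_scaleR) auto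
  also have "(\<lambda>t. \<Sum>k\<in>UNIV. t (Rep_index k) *\<^sub>R (axis k 1 :: real ^ 'k index)) = (\<lambda>t. \<chi> k. t (Rep_index k))"
  proof
    show "(\<Sum>k\<in>UNIV. t (Rep_index k) *\<^sub>R (axis k 1 :: real ^ 'k index)) = (\<chi> k. t (Rep_index k))" for t
      using basis_expansion[of "\<chi> k :: 'k index. t (Rep_index k)"] by (simp add: scalar_mult_eq_scaleR)
  qed
  finally show ?thesis .
qed

text \<open>Both measures give a box the product of its side lengths. This links the coordinate
  product in the definition of \<open>lattice_volume\<close> with the vector space in which simplex
  volumes are determinants.\<close>

lemma lborel_eq_distr_PiM_index:
  "(lborel :: (real ^ 'k::finite index) measure) =
     distr (\<Pi>\<^sub>M i\<in>{..<CARD('k)}. lborel) borel (\<lambda>t. \<chi> k. t (Rep_index k))"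
proof (rule lborel_eqI)
  let ?M = "\<Pi>\<^sub>M i\<in>{..<CARD('k)}. lborel :: real measure"
  let ?h = "\<lambda>t. (\<chi> k. t (Rep_index k)) :: real ^ 'k index"

  interpret product_sigma_finite "\<lambda>_::nat. lborel :: real measure" by standard
  fix l u :: "real ^ 'k index"
  assume lu: "\<And>b. b \<in> Basis \<Longrightarrow> l \<bullet> b \<le> u \<bullet> b"
  have lu': "l $ k \<le> u $ k" for k
    using lu[of "axis k 1"] by (auto simp: inner_axis' inner_axis Basis_vec_def)
  let ?A = "Abs_index :: nat \<Rightarrow> 'k index"
  have "?h -` box l u \<inter> space ?M = Pi\<^sub>E {..<CARD('k)} (\<lambda>i. {l $ ?A i <..< u $ ?A i})"
  proof (intro set_eqI iffI)
    fix t assume t: "t \<in> ?h -` box l u \<inter> space ?M"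
    have "l $ ?A i < t i \<and> t i < u $ ?A i" if "i < CARD('k)" for i
    proof -
      have "l $ ?A i < t (Rep_index (?A i)) \<and> t (Rep_index (?A i)) < u $ ?A i"
        using t by (simp add: mem_box_cart)
      then show ?thesis using that by (simp add: Abs_index_inverse)
    qed
    then show "t \<in> Pi\<^sub>E {..<CARD('k)} (\<lambda>i. {l $ ?A i <..< u $ ?A i})"
      using t by (simp add: space_PiM PiE_iff)
  next
    fix t assume t: "t \<in> Pi\<^sub>E {..<CARD('k)} (\<lambda>i. {l $ ?A i <..< u $ ?A i})"
    have "l $ k < t (Rep_index k) \<and> t (Rep_index k) < u $ k" for k
      using PiE_mem[OF t, of "Rep_index k"] Rep_index[of k] by (simp add: Rep_index_inverse)
    then show "t \<in> ?h -` box l u \<inter> space ?M" using t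
      by (auto simp: mem_box_cart space_PiM PiE_iff)
  qed
  then have "emeasure (distr ?M borel ?h) (box l u) =
      emeasure ?M (Pi\<^sub>E {..<CARD('k)} (\<lambda>i. {l $ ?A i <..< u $ ?A i}))"
    by (subst emeasure_distr) auto
  also have "\<dots> = (\<Prod>i<CARD('k). ennreal ((u - l) $ ?A i))"
    using lu' by (subst emeasure_PiM) auto
  also have "\<dots> = (\<Prod>k\<in>UNIV. ennreal ((u - l) $ k))"
    by (subst prod.reindex_bij_betw[OF bij_betw_Rep_index, symmetric]) (simp add: Rep_index_inverse)
  also have "\<dots> = ennreal (\<Prod>b\<in>Basis. (u - l) \<bullet> b)"
  proof -
    have "(\<Prod>b\<in>Basis. (u - l) \<bullet> b) = (\<Prod>k\<in>UNIV. (u - l) $ k)"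
      by (rule prod.reindex_bij_witness[of _ "\<lambda>k. axis k 1" "\<lambda>b. THE k. b = axis k 1"])
         (auto simp: Basis_vec_def axis_eq_axis inner_axis)
    then show ?thesis using lu' by (simp add: prod_ennreal)
  qed
  finally show "emeasure (distr ?M borel ?h) (box l u) = ennreal (\<Prod>b\<in>Basis. (u - l) \<bullet> b)" .
qed simp

section \<open>Volume of unimodular simplices and of triangulated lattice polytopes\<close>

lemma det_in_Ints:
  fixes A :: "real ^ 'n ^ 'n"
  assumes "\<And>i j. A $ i $ j \<in> \<int>"
  shows "det A \<in> \<int>"
  unfolding det_def using assms by (intro Ints_sum Ints_mult Ints_prod) auto

text \<open>The edge matrix \<open>M\<close> is integral and, by \<open>gen\<close>, has an integral
  right inverse, so its determinant is a unit of the integers.\<close>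

lemma measure_unimodular_simplex:
  fixes X :: "(real ^ 'n::{finite,wellorder}) set"
  assumes fin: "finite X" and card: "card X = Suc CARD('n)"
    and int: "X \<subseteq> {x. \<forall>i. x $ i \<in> \<int>}"
    and gen: "\<And>y. (\<And>i. y $ i \<in> \<int>) \<Longrightarrow> \<exists>u. sum u X = 1 \<and> (\<forall>x\<in>X. u x \<in> \<int>) \<and> (\<Sum>x\<in>X. u x *\<^sub>R x) = y"
  shows "measure lborel (convex hull X) = 1 / fact CARD('n)"
proof -
  obtain x0 where x0: "x0 \<in> X" using card by (metis card.empty ex_in_conv nat.distinct(1))
  have "card (X - {x0}) = CARD('n)" using card x0 fin by simp
  then obtain f :: "'n::_ \<Rightarrow> real ^ ('n::_)" where f: "bij_betw f UNIV (X - {x0})"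
    using finite_same_card_bij[of "UNIV :: ('n::_) set" "X - {x0}"] fin by auto
  define M where "M = (\<chi> i. \<chi> j. f j $ i - x0 $ i)"
  have content: "measure lborel (convex hull X) = \<bar>det M\<bar> / fact (CARD('n))"
    using content_simplex[OF fin card x0 f] by (simp add: M_def)
  have fX: "f j \<in> X" for j using f by (auto simp: bij_betw_def)
  have "\<forall>k. \<exists>u. sum u X = 1 \<and> (\<forall>x\<in>X. u x \<in> \<int>) \<and> (\<Sum>x\<in>X. u x *\<^sub>R x) = x0 + axis k 1"
  proof (intro allI gen)
    have "x0 $ i \<in> \<int>" for i using x0 int by blast
    then show "(x0 + axis k 1) $ i \<in> \<int>" for k i by (simp add: axis_def)
  qed
  from choice[OF this] obtain u where "\<forall>k. sum (u k) X = 1 \<and> (\<forall>x\<in>X. u k x \<in> \<int>) \<and>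
      (\<Sum>x\<in>X. u k x *\<^sub>R x) = x0 + axis k 1"
    by (rule exE)
  then have u: "\<And>k. sum (u k) X = 1" "\<And>k x. x \<in> X \<Longrightarrow> u k x \<in> \<int>"
      "\<And>k. (\<Sum>x\<in>X. u k x *\<^sub>R x) = x0 + axis k 1"
    by (simp_all only:)
  define N where "N = (\<chi> j. \<chi> k. u k (f j))"
  have "M ** N = mat 1"
  proof -
    have "(M ** N) $ i $ k = mat 1 $ i $ k" for i k
    proof -
      have "(M ** N) $ i $ k = (\<Sum>j\<in>UNIV. (f j $ i - x0 $ i) * u k (f j))"
        by (simp add: matrix_matrix_mult_def M_def N_def)
      also have "\<dots> = (\<Sum>x\<in>X - {x0}. (x $ i - x0 $ i) * u k x)"
        by (rule sum.reindex_bij_betw[OF f])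
      also have "\<dots> = (\<Sum>x\<in>X. (x $ i - x0 $ i) * u k x)"
        by (rule sum.mono_neutral_left) (use fin x0 in auto)
      also have "\<dots> = (\<Sum>x\<in>X. u k x *\<^sub>R x) $ i - x0 $ i * sum (u k) X"
        unfolding left_diff_distrib sum_subtractf sum_distrib_left by (simp add: mult.commute)
      finally show ?thesis by (simp add: u mat_def axis_def)
    qed
    then show ?thesis by (simp add: vec_eq_iff)
  qed
  then have MN: "det M * det N = 1" using det_mul[of M N] by (simp add: det_I)
  have "f j $ i \<in> \<int>" "x0 $ i \<in> \<int>" for i j
    using int fX[of j] x0 by auto
  then have detM: "det M \<in> \<int>" unfolding M_def by (intro det_in_Ints) simp
  obtain m :: int where m: "det M = of_int m" using detM by (rule Ints_cases)
  have detN: "det N \<in> \<int>" unfolding N_def by (intro det_in_Ints) (simp add: u(2) fX)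
  obtain n :: int where n: "det N = of_int n" using detN by (rule Ints_cases)
  have "real_of_int (m * n) = 1" using MN by (simp only: of_int_mult m n)
  then have "m = 1 \<or> m = - 1" using zmult_eq_1_iff[of m n] by (simp only: of_int_eq_1_iff) blast
  then have "\<bar>det M\<bar> = 1" using m by (elim disjE) simp_all
  then show ?thesis by (simp only: content)
qed

text \<open>In the coordinates \<open>g\<close> of the frame, whichever frame it is, the lattice of
  the affine hull becomes the integer lattice. Full cells therefore become unimodular simplices, the
  other cells become null sets, and the relative interiors of all cells partition the
  polytope.\<close>

lemma measure_lattice_frame:
  fixes P :: "'a::euclidean_space set"
  assumes V: "finite V" "V \<subseteq> integer_points" and P: "P = convex hull V"
    and dim: "aff_dim P = int CARD('k::finite)"
    and \<T>: "\<And>S. S \<in> \<T> \<Longrightarrow> S \<subseteq> V" "\<And>S. S \<in> \<T> \<Longrightarrow> \<not> affine_dependent S"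
      "\<And>q. q \<in> P \<Longrightarrow> \<exists>!S. S \<in> \<T> \<and> q \<in> rel_interior (convex hull S)"
    and uni: "\<And>S y. S \<in> \<T> \<Longrightarrow> card S = Suc CARD('k) \<Longrightarrow> y \<in> affine hull P \<inter> integer_points \<Longrightarrow>
       \<exists>u. sum u S = 1 \<and> (\<forall>x\<in>S. u x \<in> \<int>) \<and> (\<Sum>x\<in>S. u x *\<^sub>R x) = y"
    and frame: "lattice_frame P p b"
  shows "measure (\<Pi>\<^sub>M i\<in>{..<CARD('k)}. lborel)
      {t \<in> Pi\<^sub>E {..<CARD('k)} (\<lambda>_. UNIV). p + (\<Sum>i<CARD('k). t i *\<^sub>R b i) \<in> P}
    = real (card {S \<in> \<T>. card S = Suc CARD('k)}) / fact CARD('k)"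
proof -
  let ?d = "CARD('k)"
  let ?R = "Rep_index :: 'k index \<Rightarrow> nat"
  have fr: "inj_on b {..<?d}" "independent (b ` {..<?d})"
    "range (\<lambda>c :: nat \<Rightarrow> int. p + (\<Sum>i<?d. of_int (c i) *\<^sub>R b i)) = affine hull P \<inter> integer_points"
    using frame dim by (auto simp: lattice_frame_def Let_def)
  define L where "L x = (\<Sum>k\<in>UNIV. x $ k *\<^sub>R b (?R k))" for x :: "real ^ 'k index"
  define g where "g x = p + L x" for x
  have linL: "linear L" by (rule linearI) (auto simp: L_def algebra_simps sum.distrib scaleR_right.sum)
  have sumR: "(\<Sum>k\<in>UNIV. F (?R k)) = (\<Sum>i<?d. F i)" for F :: "nat \<Rightarrow> 'a"
    by (rule sum.reindex_bij_betw[OF bij_betw_Rep_index])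
  have injL: "inj L"
  proof -
    have "x = 0" if "L x = 0" for x
    proof -
      have inj: "inj_on (\<lambda>k. b (?R k)) UNIV"
        using comp_inj_on[of ?R UNIV b] fr(1) bij_betw_Rep_index[where ?'a='k]
        by (auto simp: o_def bij_betw_def)
      define u where "u v = x $ (inv_into UNIV (\<lambda>k. b (?R k)) v)" for v
      have "(\<Sum>v\<in>b ` {..<?d}. u v *\<^sub>R v) = (\<Sum>v\<in>range (\<lambda>k. b (?R k)). u v *\<^sub>R v)"
        unfolding bij_betw_imp_surj_on[OF bij_betw_Rep_index[where ?'a = 'k], symmetric] image_image ..
      also have "\<dots> = L x"
        by (subst sum.reindex[OF inj]) (simp add: L_def u_def inv_into_f_f[OF inj])
      finally have "u v = 0" if "v \<in> b ` {..<?d}" for v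
        using independentD[OF fr(2), of "b ` {..<?d}" u v] that \<open>L x = 0\<close> by auto
      then have "u (b (?R k)) = 0" for k using Rep_index[of k] by auto
      then show ?thesis by (simp add: u_def inv_into_f_f[OF inj] vec_eq_iff)
    qed
    then show ?thesis using linL linear_injective_0 by blast
  qed
  have injg: "inj g" using injL by (auto simp: g_def inj_def)
  have g_int: "g x \<in> affine hull P \<inter> integer_points \<longleftrightarrow> (\<forall>k. x $ k \<in> \<int>)" for x
  proof
    assume "g x \<in> affine hull P \<inter> integer_points"
    then obtain c :: "nat \<Rightarrow> int" where "g x = p + (\<Sum>i<?d. of_int (c i) *\<^sub>R b i)"
      unfolding fr(3)[symmetric] by blast
    also have "\<dots> = g (\<chi> k. of_int (c (?R k)))"
      unfolding g_def L_def by (simp add: sumR[symmetric])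
    finally have "x = (\<chi> k. of_int (c (?R k)))" using injg by (auto simp: inj_def)
    then show "\<forall>k. x $ k \<in> \<int>" by simp
  next
    assume "\<forall>k. x $ k \<in> \<int>"
    then have "\<forall>k. \<exists>z. x $ k = of_int z" by (auto elim: Ints_cases)
    then obtain c where c: "\<And>k. x $ k = of_int (c k)" by metis
    have "g x = p + (\<Sum>i<?d. of_int (c (Abs_index i)) *\<^sub>R b i)"
      unfolding g_def L_def sumR[symmetric] by (simp add: c Rep_index_inverse)
    then show "g x \<in> affine hull P \<inter> integer_points" unfolding fr(3)[symmetric]
      by (auto intro!: image_eqI[of _ _ "\<lambda>i. c (Abs_index i)"])
  qed
  have VP: "V \<subseteq> affine hull P" unfolding P by (metis hull_subset convex_hull_subset_affine_hull affine_hull_convex_hull)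
  have Vg: "V \<subseteq> range g"
  proof
    fix v assume "v \<in> V"
    then have "v \<in> affine hull P \<inter> integer_points" using VP V by auto
    then obtain c :: "nat \<Rightarrow> int" where "v = p + (\<Sum>i<?d. of_int (c i) *\<^sub>R b i)"
      unfolding fr(3)[symmetric] by blast
    also have "\<dots> = g (\<chi> k. of_int (c (?R k)))"
      unfolding g_def L_def by (simp add: sumR[symmetric])
    finally show "v \<in> range g" by blast
  qed
  have affg: "range g = affine hull P"
  proof
    have "p = g 0" by (simp add: g_def linear_0[OF linL])
    then have p: "p \<in> affine hull P" using g_int[of 0] by simp
    have "subspace ((\<lambda>x. - p + x) ` (affine hull P))"
      using p affine_diffs_subspace[OF affine_affine_hull] by blast
    moreover have "b (?R k) \<in> (\<lambda>x. - p + x) ` (affine hull P)" for k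
    proof -
      have "L (axis k 1) = (\<Sum>j\<in>UNIV. if j = k then b (?R j) else 0)"
        unfolding L_def by (intro sum.cong) (auto simp: axis_def)
      then have "g (axis k 1) = p + b (?R k)" by (simp add: g_def)
      moreover have "\<forall>i. axis k (1::real) $ i \<in> \<int>" by (simp add: axis_def)
      ultimately have "p + b (?R k) \<in> affine hull P" using g_int[of "axis k 1"] by simp
      then show ?thesis by (auto intro!: image_eqI[of _ _ "p + b (?R k)"])
    qed
    ultimately have L: "L x \<in> (\<lambda>x. - p + x) ` (affine hull P)" for x
      unfolding L_def by (intro subspace_sum subspace_scale) auto
    have "g x \<in> affine hull P" for x
      using L[of x] by (auto simp: g_def)
    then show "range g \<subseteq> affine hull P" by blast
    have "affine (range L)" using linL by (intro subspace_imp_affine linear_subspace_image) auto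
    then have "affine ((+) p ` range L)" using affine_translation[of "range L" p] by blast
    moreover have "(+) p ` range L = range g" by (auto simp: g_def)
    ultimately have "affine (range g)" by simp
    then show "affine hull P \<subseteq> range g" unfolding P affine_hull_convex_hull
      using Vg by (simp add: hull_minimal)
  qed
  define X where "X S = g -` rel_interior (convex hull S)" for S
  have g_hull: "g ` rel_interior (convex hull T) = rel_interior (convex hull (g ` T))" for T
  proof -
    have g: "g ` A = (+) p ` (L ` A)" for A by (auto simp: g_def)
    have "rel_interior (convex hull (g ` T)) = (+) p ` rel_interior (convex hull (L ` T))"
      unfolding g by (simp only: convex_hull_translation rel_interior_translation)
    also have "convex hull (L ` T) = L ` (convex hull T)"
      by (rule convex_hull_linear_image[OF linL, symmetric])
    also have "rel_interior \<dots> = L ` rel_interior (convex hull T)"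
      using rel_interior_injective_linear_image linL injL linear_conv_bounded_linear by blast
    finally show ?thesis by (simp only: g)
  qed
  have imgS: "g ` (g -` S) = S" if "S \<subseteq> V" for S using that Vg by auto
  have X: "X S = rel_interior (convex hull (g -` S))" if "S \<subseteq> V" for S
    using g_hull[of "g -` S"] imgS[OF that] injg unfolding X_def by (metis inj_vimage_image_eq)
  have finS: "finite (g -` S)" if "S \<subseteq> V" for S
    using that V injg by (meson finite_vimageI finite_subset)
  have cardS: "card (g -` S) = card S" if "S \<subseteq> V" for S
    using imgS[OF that] by (metis card_image injg inj_on_subset subset_UNIV)
  have bddS: "bounded (convex hull (g -` S))" if "S \<subseteq> V" for S
    using finS[OF that] by (intro bounded_convex_hull finite_imp_bounded)
  have lmX: "X S \<in> lmeasurable" if "S \<subseteq> V" for S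
    unfolding X[OF that] using bddS[OF that]
    by (intro measurable_convex convex_rel_interior) (auto intro: bounded_subset[OF _ rel_interior_subset])
  have leS: "card S \<le> Suc ?d" if "S \<in> \<T>" for S
  proof -
    have "S \<subseteq> P" using \<T>(1)[OF that] hull_subset[of V convex] unfolding P by (rule order_trans)
    then have "aff_dim S \<le> ?d" using aff_dim_subset[of S P] dim by simp
    moreover have "aff_dim S = int (card S) - 1"
      using aff_dim_affine_independent[OF \<T>(2)[OF that]] by simp
    ultimately show ?thesis by linarith
  qed
  have measX: "measure lebesgue (X S) = (if card S = Suc ?d then 1 / fact ?d else 0)" if S: "S \<in> \<T>" for S
  proof (cases "card S = Suc ?d")
    case True
    note SV = \<T>(1)[OF S]
    let ?C = "convex hull (g -` S)"
    have "measure lborel ?C = 1 / fact CARD('k index)"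
    proof (rule measure_unimodular_simplex)
      show "finite (g -` S)" "card (g -` S) = Suc CARD('k index)"
        using finS[OF SV] cardS[OF SV] True by auto
      show "g -` S \<subseteq> {x. \<forall>i. x $ i \<in> \<int>}" using g_int SV V VP by blast
      fix y :: "real ^ 'k index" assume "\<And>i. y $ i \<in> \<int>"
      then have "g y \<in> affine hull P \<inter> integer_points" using g_int by blast
      from uni[OF S True this] obtain u where
        u: "sum u S = 1" "\<forall>x\<in>S. u x \<in> \<int>" "(\<Sum>x\<in>S. u x *\<^sub>R x) = g y" by blast
      have bij: "bij_betw g (g -` S) S" using imgS[OF SV] injg by (auto simp: bij_betw_def inj_on_def)
      have 1: "(\<Sum>x\<in>g -` S. u (g x)) = 1" using sum.reindex_bij_betw[OF bij, of u] u by simp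
      have "g y = (\<Sum>x\<in>g -` S. u (g x) *\<^sub>R g x)"
        using sum.reindex_bij_betw[OF bij, of "\<lambda>x. u x *\<^sub>R x"] u by simp
      also have "\<dots> = (\<Sum>x\<in>g -` S. u (g x)) *\<^sub>R p + (\<Sum>x\<in>g -` S. u (g x) *\<^sub>R L x)"
        by (simp add: g_def scaleR_add_right sum.distrib scaleR_left.sum)
      also have "\<dots> = g (\<Sum>x\<in>g -` S. u (g x) *\<^sub>R x)"
        using 1 by (simp add: g_def linear_sum[OF linL] linear_cmul[OF linL])
      finally have "y = (\<Sum>x\<in>g -` S. u (g x) *\<^sub>R x)" using injg by (simp add: inj_def)
      then show "\<exists>u. sum u (g -` S) = 1 \<and> (\<forall>x\<in>g -` S. u x \<in> \<int>) \<and> (\<Sum>x\<in>g -` S. u x *\<^sub>R x) = y"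
        using 1 u by (intro exI[of _ "\<lambda>x. u (g x)"]) auto
    qed
    moreover have "measure lebesgue ?C = measure lborel ?C"
      using finS[OF SV] by (intro measure_completion) (auto intro!: borel_closed compact_imp_closed finite_imp_compact_convex_hull)
    \<comment> \<open>\<open>X S\<close> lies between the interior of the simplex and the simplex
      itself, and the frontier of a convex set is negligible.\<close>
    moreover have "measure lebesgue (interior ?C) = measure lebesgue ?C"
      by (intro measure_interior bddS SV negligible_convex_frontier convex_convex_hull)
    moreover have "measure lebesgue (interior ?C) \<le> measure lebesgue (X S)"
      by (intro measure_mono_fmeasurable lmX SV)
         (auto simp: X[OF SV] intro: interior_subset_rel_interior[THEN subsetD])
    moreover have "measure lebesgue (X S) \<le> measure lebesgue ?C"
      using lmX[OF SV] bddS[OF SV]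
      by (intro measure_mono_fmeasurable measurable_convex)
         (auto simp: X[OF SV] intro: rel_interior_subset[THEN subsetD])
    ultimately show ?thesis using True by simp
  next
    case False
    note SV = \<T>(1)[OF S]
    have "card (g -` S) \<le> DIM(real ^ 'k index)" using leS[OF S] False cardS[OF SV] by simp
    then have "interior (convex hull (g -` S)) = {}" by (rule empty_interior_convex_hull[OF finS[OF SV]])
    then have "negligible (convex hull (g -` S))" by (simp add: negligible_convex_interior)
    then have "negligible (X S)" unfolding X[OF SV] by (rule negligible_subset) (rule rel_interior_subset)
    then show ?thesis using False by (simp add: negligible_imp_measure0)
  qed
  have fT: "finite \<T>" using \<T>(1) V(1) by (intro finite_subset[of \<T> "Pow V"]) auto
  have cover: "g -` P = (\<Union>S\<in>\<T>. X S)"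
  proof (intro equalityI subsetI)
    fix x assume "x \<in> g -` P"
    then obtain S where "S \<in> \<T>" "g x \<in> rel_interior (convex hull S)"
      using ex1_implies_ex[OF \<T>(3)[of "g x"]] by auto
    then show "x \<in> (\<Union>S\<in>\<T>. X S)" by (auto simp: X_def)
  next
    fix x assume "x \<in> (\<Union>S\<in>\<T>. X S)"
    then obtain S where S: "S \<in> \<T>" "g x \<in> rel_interior (convex hull S)" by (auto simp: X_def)
    have "convex hull S \<subseteq> P" unfolding P by (rule hull_mono[OF \<T>(1)[OF S(1)]])
    then show "x \<in> g -` P" using S(2) rel_interior_subset[of "convex hull S"] by auto
  qed
  have disj: "disjoint_family_on X \<T>"
  proof -
    have "S = S'" if "S \<in> \<T>" "S' \<in> \<T>" "x \<in> X S" "x \<in> X S'" for S S' x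
    proof -
      have "g x \<in> P" using that(1,3) cover by auto
      then show ?thesis using ex1E[OF \<T>(3)[of "g x"], of "S = S'"] that unfolding X_def
        by (metis vimage_eq)
    qed
    then show ?thesis by (auto simp: disjoint_family_on_def)
  qed
  have "measure lebesgue (g -` P) = (\<Sum>S\<in>\<T>. measure lebesgue (X S))"
    unfolding cover
  proof (rule measure_finite_Union[OF fT _ disj])
    show "X ` \<T> \<subseteq> sets lebesgue" using lmX \<T>(1) by (blast intro: fmeasurableD)
    show "emeasure lebesgue (X S) \<noteq> \<infinity>" if "S \<in> \<T>" for S
      using fmeasurableD2[OF lmX[OF \<T>(1)[OF that]]] unfolding infinity_ennreal_def .
  qed
  also have "\<dots> = (\<Sum>S\<in>\<T>. if card S = Suc ?d then 1 / fact ?d else 0)"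
    using measX by (rule sum.cong[OF refl])
  also have "\<dots> = (\<Sum>S\<in>{S \<in> \<T>. card S = Suc ?d}. 1 / fact ?d)"
    by (rule sum.inter_filter[OF fT, symmetric])
  finally have main: "measure lebesgue (g -` P) = real (card {S \<in> \<T>. card S = Suc ?d}) / fact ?d" by simp
  have "closed P" unfolding P using V by (intro compact_imp_closed finite_imp_compact_convex_hull)
  moreover have "continuous_on UNIV g"
    unfolding g_def using linL by (intro continuous_intros linear_continuous_on) (simp add: linear_conv_bounded_linear)
  ultimately have cl: "closed (g -` P)" by (rule closed_vimage)
  let ?M = "\<Pi>\<^sub>M i\<in>{..<?d}. lborel :: real measure"
  let ?h = "\<lambda>t. (\<chi> k. t (?R k))"
  have "measure lebesgue (g -` P) = measure lborel (g -` P)"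
    using cl by (intro measure_completion) auto
  also have "\<dots> = measure (distr ?M borel ?h) (g -` P)"
    by (subst lborel_eq_distr_PiM_index) (rule refl)
  also have "\<dots> = measure ?M (?h -` (g -` P) \<inter> space ?M)"
    by (rule measure_distr[OF measurable_index_vec]) (use cl in auto)
  also have "?h -` (g -` P) \<inter> space ?M = {t \<in> Pi\<^sub>E {..<?d} (\<lambda>_. UNIV). p + (\<Sum>i<?d. t i *\<^sub>R b i) \<in> P}"
  proof -
    have "g (?h t) = p + (\<Sum>i<?d. t i *\<^sub>R b i)" for t
      using sumR[of "\<lambda>i. t i *\<^sub>R b i"] by (simp add: g_def L_def)
    then show ?thesis by (auto simp: space_PiM)
  qed
  finally show ?thesis using main by simp
qed

section \<open>Existence of a lattice frame\<close>

lemma integer_points_diff: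
  "x \<in> integer_points \<Longrightarrow> y \<in> integer_points \<Longrightarrow> x - y \<in> integer_points"
  by (simp add: integer_points_def inner_diff_left)

lemma integer_points_scale:
  "x \<in> integer_points \<Longrightarrow> of_int k *\<^sub>R x \<in> integer_points"
  by (simp add: integer_points_def)

lemma integer_points_add:
  "x \<in> integer_points \<Longrightarrow> y \<in> integer_points \<Longrightarrow> x + y \<in> integer_points"
  by (simp add: integer_points_def inner_add_left)

lemma integer_points_sum:
  "(\<And>i. i \<in> I \<Longrightarrow> f i \<in> integer_points) \<Longrightarrow> sum f I \<in> integer_points"
  by (simp add: integer_points_def inner_sum_left Ints_sum)

text \<open>Integral affine coordinates with total 1 are integral linear coordinates around any one
  vertex \<open>p\<close>, so the differences to \<open>p\<close> form a lattice basis.\<close>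

lemma lattice_frame_exists:
  fixes S P :: "'a::euclidean_space set"
  assumes S: "finite S" "\<not> affine_dependent S" "S \<subseteq> affine hull P \<inter> integer_points"
    and card: "card S = Suc (nat (aff_dim P))"
    and uni: "\<And>y. y \<in> affine hull P \<inter> integer_points \<Longrightarrow>
       \<exists>u. sum u S = 1 \<and> (\<forall>x\<in>S. u x \<in> \<int>) \<and> (\<Sum>x\<in>S. u x *\<^sub>R x) = y"
  shows "\<exists>p b. lattice_frame P p b"
proof -
  let ?d = "nat (aff_dim P)"
  obtain p where p: "p \<in> S" using card by (cases "S = {}") auto
  have "card (S - {p}) = ?d" using card p S(1) by simp
  then obtain f where f: "bij_betw f {..<?d} (S - {p})"
    using ex_bij_betw_nat_finite[of "S - {p}"] S(1) by (auto simp: lessThan_atLeast0)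
  define b where "b i = f i - p" for i
  have inj: "inj_on b {..<?d}" using f by (auto simp: b_def inj_on_def bij_betw_def)
  have "b ` {..<?d} = (\<lambda>x. - p + x) ` (S - {p})"
    unfolding bij_betw_imp_surj_on[OF f, symmetric] by (simp add: b_def image_image)
  moreover have "insert p (S - {p}) = S" using p by blast
  ultimately have indep: "independent (b ` {..<?d})"
    using S(2) affine_dependent_iff_dependent[of p "S - {p}"] by simp
  have fS: "f i \<in> S" if "i < ?d" for i using f that by (auto simp: bij_betw_def)
  have sub: "subspace ((\<lambda>x. - p + x) ` (affine hull P))"
    using p S affine_diffs_subspace[OF affine_affine_hull] by blast
  have range: "range (\<lambda>c :: nat \<Rightarrow> int. p + (\<Sum>i<?d. of_int (c i) *\<^sub>R b i)) = affine hull P \<inter> integer_points"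
  proof (intro equalityI subsetI)
    fix y assume "y \<in> range (\<lambda>c :: nat \<Rightarrow> int. p + (\<Sum>i<?d. of_int (c i) *\<^sub>R b i))"
    then obtain c :: "nat \<Rightarrow> int" where y: "y = p + (\<Sum>i<?d. of_int (c i) *\<^sub>R b i)" by blast
    have "b i \<in> (\<lambda>x. - p + x) ` (affine hull P)" if "i < ?d" for i
      using fS[OF that] S(3) by (auto simp: b_def)
    then have "(\<Sum>i<?d. of_int (c i) *\<^sub>R b i) \<in> (\<lambda>x. - p + x) ` (affine hull P)"
      using sub by (intro subspace_sum subspace_scale) auto
    then have "y \<in> affine hull P" by (auto simp: y)
    moreover have "y \<in> integer_points" unfolding y b_def using p fS S(3)
      by (intro integer_points_add integer_points_sum integer_points_scale integer_points_diff) auto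
    ultimately show "y \<in> affine hull P \<inter> integer_points" by blast
  next
    fix y assume "y \<in> affine hull P \<inter> integer_points"
    from uni[OF this] obtain u where
      u: "sum u S = 1" "\<forall>x\<in>S. u x \<in> \<int>" "(\<Sum>x\<in>S. u x *\<^sub>R x) = y" by blast
    have "y = (\<Sum>x\<in>S. u x *\<^sub>R (x - p)) + sum u S *\<^sub>R p"
      using u(3) by (simp add: scaleR_diff_right sum_subtractf scaleR_left.sum)
    also have "(\<Sum>x\<in>S. u x *\<^sub>R (x - p)) = (\<Sum>x\<in>S - {p}. u x *\<^sub>R (x - p))"
      by (rule sum.mono_neutral_right) (use S(1) in auto)
    also have "\<dots> = (\<Sum>i<?d. u (f i) *\<^sub>R (f i - p))"
      by (rule sum.reindex_bij_betw[OF f, symmetric])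
    \<comment> \<open>The coefficients are reals with integral values; the floor yields the integers
      that a frame asks for.\<close>
    also have "\<dots> = (\<Sum>i<?d. of_int \<lfloor>u (f i)\<rfloor> *\<^sub>R b i)"
      by (intro sum.cong refl) (use u(2) fS in \<open>simp add: b_def\<close>)
    finally have "y = p + (\<Sum>i<?d. of_int \<lfloor>u (f i)\<rfloor> *\<^sub>R b i)" using u(1) by simp
    then show "y \<in> range (\<lambda>c :: nat \<Rightarrow> int. p + (\<Sum>i<?d. of_int (c i) *\<^sub>R b i))"
      by (intro range_eqI[of _ _ "\<lambda>i. \<lfloor>u (f i)\<rfloor>"])
  qed
  show ?thesis using inj indep range unfolding lattice_frame_def Let_def by blast
qed

section \<open>Draconian sequences and assignments\<close>

text \<open>
  Rado's theorem for the transversal polymatroid. When the vertex \<open>r\<close> is removed from \<open>R\<close>, the sets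
  violating the bound are closed under intersection by submodularity, so \<open>r\<close> can be assigned to a
  neighbour in the smallest of them.
\<close>

lemma draconian_assignment:
  fixes G :: "('m::finite, 'n::finite) bigraph"
  assumes "finite R" "\<And>J. (\<Sum>i\<in>J. a i) \<le> card ((\<Union>i\<in>J. nbrs G i) \<inter> R)"
  shows "\<exists>\<sigma> :: 'n \<Rightarrow> 'm option. (\<forall>j i. \<sigma> j = Some i \<longrightarrow> (i, j) \<in> G \<and> j \<in> R) \<and> (\<forall>i. card {j. \<sigma> j = Some i} = a i)"
  using assms
proof (induction R arbitrary: a rule: finite_induct)
  case empty
  have "a i = 0" for i using empty[of "{i}"] by simp
  then show ?case by (intro exI[of _ "\<lambda>_. None"]) simp
next
  case (insert r R)
  let ?N = "\<lambda>J. \<Union>i\<in>J. nbrs G i"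
  define viol where "viol J \<longleftrightarrow> card (?N J \<inter> R) < sum a J" for J
  have step: "card (?N J \<inter> insert r R) \<le> Suc (card (?N J \<inter> R))" for J
    by (simp add: Int_insert_right card_insert_if)
  show ?case
  proof (cases "\<exists>J. viol J")
    case False
    then obtain \<sigma> :: "'n \<Rightarrow> 'm option" where
      "\<forall>j i. \<sigma> j = Some i \<longrightarrow> (i, j) \<in> G \<and> j \<in> R" "\<forall>i. card {j. \<sigma> j = Some i} = a i"
      using insert.IH[of a] by (auto simp: viol_def not_less)
    then show ?thesis by (intro exI[of _ \<sigma>]) auto
  next
    case True
    then obtain J1 where "viol J1" by blast
    from ex_has_least_nat[of viol, OF this, of card]
    obtain J0 where J0: "viol J0" "\<And>J. viol J \<Longrightarrow> card J0 \<le> card J" by blast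
    have inter: "viol (J \<inter> J0)" if J: "viol J" for J
    proof -
      have "card (?N (J \<inter> J0) \<inter> R) + card (?N (J \<union> J0) \<inter> R) \<le>
          card ((?N J \<inter> R) \<inter> (?N J0 \<inter> R)) + card ((?N J \<inter> R) \<union> (?N J0 \<inter> R))"
        by (intro add_mono card_mono) auto
      also have "\<dots> = card (?N J \<inter> R) + card (?N J0 \<inter> R)"
        using card_Un_Int[of "?N J \<inter> R" "?N J0 \<inter> R"] by simp
      finally have 1: "card (?N (J \<inter> J0) \<inter> R) + card (?N (J \<union> J0) \<inter> R) \<le> card (?N J \<inter> R) + card (?N J0 \<inter> R)" .
      \<comment> \<open>On any set the bound fails by at most one, since \<open>r\<close> is a
        single neighbour. The violations at \<open>J\<close> and \<open>J0\<close> add up to at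
        least two, so the union cannot account for both and the intersection is violated as
        well.\<close>
      have 2: "sum a (J \<union> J0) \<le> Suc (card (?N (J \<union> J0) \<inter> R))"
        using insert.prems[of "J \<union> J0"] step[of "J \<union> J0"] by linarith
      have 3: "sum a (J \<union> J0) + sum a (J \<inter> J0) = sum a J + sum a J0"
        by (rule sum.union_inter) auto
      show ?thesis using 1 2 3 J J0(1) unfolding viol_def by linarith
    qed
    have J0_sub: "J0 \<subseteq> J" if "viol J" for J
      using J0(2)[OF inter[OF that]] card_seteq[of J0 "J \<inter> J0"] by auto
    have "card (?N J0 \<inter> R) < card (?N J0 \<inter> insert r R)"
      using J0(1) insert.prems[of J0] unfolding viol_def by linarith
    then have "r \<in> ?N J0" by (cases "r \<in> ?N J0") auto
    then obtain i where i: "i \<in> J0" "(i, r) \<in> G" by (auto simp: nbrs_def)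
    \<comment> \<open>Otherwise \<open>i\<close> could be removed from \<open>J0\<close> and the
      rest would still violate the bound, against minimality. Positivity makes the subtraction in
      \<open>a'\<close> exact.\<close>
    have ai: "a i \<noteq> 0"
    proof
      assume "a i = 0"
      then have "sum a (J0 - {i}) = sum a J0" by (intro sum.mono_neutral_left) auto
      moreover have "card (?N (J0 - {i}) \<inter> R) \<le> card (?N J0 \<inter> R)" by (intro card_mono) auto
      ultimately have "viol (J0 - {i})" using J0(1) by (simp add: viol_def)
      then show False using J0_sub i by blast
    qed
    define a' where "a' = a(i := a i - 1)"
    \<comment> \<open>Every violating set contains \<open>J0\<close> and hence \<open>i\<close>, so
      lowering \<open>a i\<close> by one repairs all of them at once.\<close>
    have "sum a' J \<le> card (?N J \<inter> R)" for J
    proof (cases "viol J")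
      case True
      then have "i \<in> J" using J0_sub i by blast
      then have "sum a' J + 1 = sum a J"
        using ai by (simp add: a'_def sum.remove[of J i] sum.remove[of J i a])
      then show ?thesis using insert.prems[of J] step[of J] by linarith
    next
      case False
      have "sum a' J \<le> sum a J" by (intro sum_mono) (simp add: a'_def)
      then show ?thesis using False by (simp add: viol_def)
    qed
    then obtain \<sigma> :: "'n \<Rightarrow> 'm option" where \<sigma>:
      "\<forall>j i. \<sigma> j = Some i \<longrightarrow> (i, j) \<in> G \<and> j \<in> R" "\<forall>i. card {j. \<sigma> j = Some i} = a' i"
      using insert.IH[of a'] by blast
    let ?\<sigma> = "\<sigma>(r := Some i)"
    have \<sigma>r: "\<sigma> r = None" using \<sigma>(1) insert.hyps by (cases "\<sigma> r") auto
    have "card {j. ?\<sigma> j = Some k} = a k" for k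
    proof (cases "k = i")
      case True
      then have "{j. ?\<sigma> j = Some k} = insert r {j. \<sigma> j = Some i}" using \<sigma>r by auto
      then show ?thesis using \<sigma>(2) \<sigma>r True ai by (simp add: a'_def)
    next
      case False
      then have "{j. ?\<sigma> j = Some k} = {j. \<sigma> j = Some k}" using \<sigma>r by auto
      then show ?thesis using \<sigma>(2) False by (simp add: a'_def)
    qed
    then show ?thesis using \<sigma>(1) i by (intro exI[of _ ?\<sigma>]) auto
  qed
qed

section \<open>Forests as independent sets of vertices\<close>

definition edge_vec :: "'p::finite \<times> 'q::finite \<Rightarrow> (real ^ 'p) \<times> (real ^ 'q)" where
  "edge_vec e = (axis (fst e) 1, axis (snd e) 1)"

lemma inj_edge_vec: "inj edge_vec"
  by (auto simp: inj_def edge_vec_def axis_eq_axis prod_eq_iff)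

lemma root_polytope_eq: "root_polytope H = convex hull (edge_vec ` H)"
proof -
  have "{(axis i 1, axis j 1) | i j. (i, j) \<in> H} = edge_vec ` H"
    by (force simp: edge_vec_def)
  then show ?thesis by (simp only: root_polytope_def)
qed

lemma sum_fst_edge_vec:
  "(\<Sum>k\<in>A. fst (\<Sum>e\<in>T. \<phi> e *\<^sub>R edge_vec e) $ k) = (\<Sum>e\<in>T. if fst e \<in> A then \<phi> e else 0)"
proof -
  have "(\<Sum>k\<in>A. fst (\<Sum>e\<in>T. \<phi> e *\<^sub>R edge_vec e) $ k) = (\<Sum>k\<in>A. \<Sum>e\<in>T. if fst e = k then \<phi> e else 0)"
    by (intro sum.cong refl) (auto simp: fst_sum edge_vec_def axis_def intro!: sum.cong)
  also have "\<dots> = (\<Sum>e\<in>T. if fst e \<in> A then \<phi> e else 0)"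
    by (subst sum.swap) (simp add: sum.delta)
  finally show ?thesis .
qed

lemma sum_snd_edge_vec:
  "(\<Sum>k\<in>B. snd (\<Sum>e\<in>T. \<phi> e *\<^sub>R edge_vec e) $ k) = (\<Sum>e\<in>T. if snd e \<in> B then \<phi> e else 0)"
proof -
  have "(\<Sum>k\<in>B. snd (\<Sum>e\<in>T. \<phi> e *\<^sub>R edge_vec e) $ k) = (\<Sum>k\<in>B. \<Sum>e\<in>T. if snd e = k then \<phi> e else 0)"
    by (intro sum.cong refl) (auto simp: snd_sum edge_vec_def axis_def intro!: sum.cong)
  also have "\<dots> = (\<Sum>e\<in>T. if snd e \<in> B then \<phi> e else 0)"
    by (subst sum.swap) (simp add: sum.delta)
  finally show ?thesis .
qed

lemma sum_edge_vec_eqI: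
  assumes "\<And>i. (\<Sum>e\<in>T. if fst e = i then \<phi> e else 0) = x $ i"
    "\<And>j. (\<Sum>e\<in>T. if snd e = j then \<phi> e else 0) = y $ j"
  shows "(\<Sum>e\<in>T. \<phi> e *\<^sub>R edge_vec e) = (x, y)"
proof -
  have "fst (\<Sum>e\<in>T. \<phi> e *\<^sub>R edge_vec e) $ i = x $ i" for i
    using sum_fst_edge_vec[of \<phi> T "{i}"] assms(1)[of i] by simp
  moreover have "snd (\<Sum>e\<in>T. \<phi> e *\<^sub>R edge_vec e) $ j = y $ j" for j
    using sum_snd_edge_vec[of \<phi> T "{j}"] assms(2)[of j] by simp
  ultimately show ?thesis by (simp add: prod_eq_iff vec_eq_iff)
qed

text \<open>All edge vectors have left coordinate sum 1, so the coefficients of a linear dependence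
  automatically sum to 0.\<close>

lemma affine_dependent_edge_vec_iff:
  "affine_dependent (edge_vec ` T) \<longleftrightarrow> dependent (edge_vec ` T)"
proof
  assume "dependent (edge_vec ` T)"
  then obtain u v where u: "v \<in> edge_vec ` T" "u v \<noteq> 0" "(\<Sum>v\<in>edge_vec ` T. u v *\<^sub>R v) = 0"
    unfolding dependent_finite[OF finite_imageI[OF finite]] by blast
  have inj: "inj_on edge_vec T" using inj_edge_vec by (rule inj_on_subset) simp
  have "(\<Sum>v\<in>edge_vec ` T. u v) = (\<Sum>e\<in>T. if fst e \<in> UNIV then u (edge_vec e) else 0)"
    by (simp add: sum.reindex[OF inj])
  also have "\<dots> = (\<Sum>k\<in>UNIV. fst (\<Sum>e\<in>T. u (edge_vec e) *\<^sub>R edge_vec e) $ k)"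
    by (rule sum_fst_edge_vec[symmetric])
  also have "(\<Sum>e\<in>T. u (edge_vec e) *\<^sub>R edge_vec e) = 0"
    using u(3) by (simp add: sum.reindex[OF inj])
  finally have "(\<Sum>v\<in>edge_vec ` T. u v) = 0" by simp
  then show "affine_dependent (edge_vec ` T)"
    using u by (subst affine_dependent_explicit_finite) auto
qed (rule affine_dependent_imp_dependent)

text \<open>The forest bound as a dimension count: all edges between \<open>A\<close> and
  \<open>B\<close> lie in the span of the star at \<open>i0\<close> and the differences of left
  vertices, which are \<open>card A + card B - 1\<close> vectors.\<close>

lemma card_independent_edges:
  fixes T :: "('p::finite \<times> 'q::finite) set"
  assumes T: "independent (edge_vec ` T)" "T \<subseteq> A \<times> B" and ne: "A \<noteq> {} \<or> B \<noteq> {}"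
  shows "card T + 1 \<le> card A + card B"
proof (cases "A = {} \<or> B = {}")
  case True
  then have "T = {}" using T by auto
  moreover have "0 < card A \<or> 0 < card B" using ne by (simp add: card_gt_0_iff)
  ultimately show ?thesis by auto
next
  case False
  then obtain i0 where i0: "i0 \<in> A" by blast
  let ?W1 = "(\<lambda>i. (axis i 1 - axis i0 1, 0) :: (real ^ 'p) \<times> (real ^ 'q)) ` (A - {i0})"
  let ?W2 = "(\<lambda>j. edge_vec (i0, j)) ` B"
  have "edge_vec e \<in> span (?W1 \<union> ?W2)" if e: "e \<in> T" for e
  proof -
    obtain i j where ij: "e = (i, j)" "i \<in> A" "j \<in> B" using T(2) e by blast
    have 1: "edge_vec (i0, j) \<in> span (?W1 \<union> ?W2)" using ij by (intro span_base) blast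
    have 2: "((axis i 1 - axis i0 1, 0) :: (real ^ 'p) \<times> (real ^ 'q)) \<in> span (?W1 \<union> ?W2)"
    proof (cases "i = i0")
      case True
      then have "((axis i 1 - axis i0 1, 0) :: (real ^ 'p) \<times> (real ^ 'q)) = 0" by (simp add: zero_prod_def)
      then show ?thesis by (simp only: span_zero)
    next
      case False
      then show ?thesis using ij by (intro span_base) blast
    qed
    have "edge_vec e = (axis i 1 - axis i0 1, 0) + edge_vec (i0, j)" by (simp add: edge_vec_def ij)
    then show ?thesis using span_add[OF 2 1] by simp
  qed
  then have "edge_vec ` T \<subseteq> span (?W1 \<union> ?W2)" by (rule image_subsetI)
  from independent_span_bound[OF _ T(1) this]
  have "card (edge_vec ` T) \<le> card (?W1 \<union> ?W2)" by simp
  also have "card (edge_vec ` T) = card T"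
    by (rule card_image[OF inj_on_subset[OF inj_edge_vec subset_UNIV]])
  also have "card (?W1 \<union> ?W2) \<le> card (A - {i0}) + card B"
    by (rule order_trans[OF card_Un_le]) (intro add_mono card_image_le; simp)
  also have "card (A - {i0}) = card A - 1" using i0 by simp
  finally have "card T \<le> card A - 1 + card B" .
  moreover have "card A > 0" using i0 by (auto simp: card_gt_0_iff)
  ultimately show ?thesis by linarith
qed

text \<open>
  \<open>A\<close> and \<open>B\<close> are the vertices on the side of \<open>fst e\<close> when \<open>e\<close> is removed from the forest \<open>T\<close>;
  reachability is expressed through the span of the remaining edges.
\<close>

lemma fundamental_cut:
  fixes T :: "('p::finite \<times> 'q::finite) set"
  assumes T: "independent (edge_vec ` T)" and e: "e \<in> T"
  obtains A B where "fst e \<in> A" "snd e \<notin> B" "\<And>f. f \<in> T \<Longrightarrow> f \<noteq> e \<Longrightarrow> fst f \<in> A \<longleftrightarrow> snd f \<in> B"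
proof -
  let ?W = "span (edge_vec ` (T - {e}))"
  define A where "A = {k. (axis (fst e) 1 - axis k 1, 0) \<in> ?W}"
  define B where "B = {l. (axis (fst e) 1, axis l 1) \<in> ?W}"
  have "fst e \<in> A" using span_zero[of "edge_vec ` (T - {e})"] by (simp add: A_def zero_prod_def)
  moreover have "snd e \<notin> B"
  proof
    assume "snd e \<in> B"
    then have "edge_vec e \<in> ?W" by (simp add: B_def edge_vec_def)
    moreover have "edge_vec ` (T - {e}) = edge_vec ` T - {edge_vec e}"
      by (simp add: image_set_diff[OF inj_edge_vec])
    ultimately show False using T e unfolding dependent_def by auto
  qed
  moreover have "fst f \<in> A \<longleftrightarrow> snd f \<in> B" if f: "f \<in> T" "f \<noteq> e" for f
  proof -
    have W: "edge_vec f \<in> ?W" using f by (intro span_base) blast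
    have eq: "(axis (fst e) 1 - axis (fst f) 1, 0) + edge_vec f = (axis (fst e) 1, axis (snd f) 1)"
      by (simp add: edge_vec_def)
    show ?thesis unfolding A_def B_def mem_Collect_eq eq[symmetric]
      using span_add_eq2[OF W] by blast
  qed
  ultimately show ?thesis by (rule that)
qed

text \<open>Every edge other than \<open>e\<close> is counted in both sums or in neither, so it
  cancels.\<close>

lemma coefficient_eq_cut:
  assumes e: "e \<in> T" and AB: "fst e \<in> A" "snd e \<notin> B"
    "\<And>f. f \<in> T \<Longrightarrow> f \<noteq> e \<Longrightarrow> fst f \<in> A \<longleftrightarrow> snd f \<in> B"
    and xy: "(\<Sum>f\<in>T. \<phi> f *\<^sub>R edge_vec f) = (x, y)"
  shows "\<phi> e = (\<Sum>k\<in>A. x $ k) - (\<Sum>l\<in>B. y $ l)"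
proof -
  have "(\<Sum>k\<in>A. x $ k) - (\<Sum>l\<in>B. y $ l) =
      (\<Sum>f\<in>T. if fst f \<in> A then \<phi> f else 0) - (\<Sum>f\<in>T. if snd f \<in> B then \<phi> f else 0)"
    using sum_fst_edge_vec[of \<phi> T A] sum_snd_edge_vec[of \<phi> T B] xy by simp
  also have "\<dots> = (\<Sum>f\<in>T. if f = e then \<phi> f else 0)"
    unfolding sum_subtractf[symmetric] by (intro sum.cong refl) (use AB in auto)
  also have "\<dots> = \<phi> e" using e by simp
  finally show ?thesis by simp
qed

text \<open>An edge outside the span could be added to \<open>T\<close>, against the forest bound.
  So the span contains the edge vectors of the complete bipartite graph, which generate all pairs
  with equal coordinate sums.\<close>

lemma span_spanning_edges:
  fixes T :: "('p::finite \<times> 'q::finite) set"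
  assumes T: "independent (edge_vec ` T)" and card: "card T + 1 = CARD('p) + CARD('q)"
    and xy: "(\<Sum>i\<in>UNIV. x $ i) = (\<Sum>j\<in>UNIV. y $ j)"
  shows "\<exists>\<phi>. (\<Sum>f\<in>T. \<phi> f *\<^sub>R edge_vec f) = (x, y)"
proof -
  let ?W = "span (edge_vec ` T)"
  have W: "edge_vec e \<in> ?W" for e
  proof (rule ccontr)
    assume e: "edge_vec e \<notin> ?W"
    then have "independent (edge_vec ` (insert e T))"
      using T by (simp add: independent_insert)
    then have "card (insert e T) + 1 \<le> CARD('p) + CARD('q)"
      by (rule card_independent_edges) auto
    moreover have "e \<notin> T" using e span_base[of "edge_vec e" "edge_vec ` T"] by blast
    ultimately show False using card by simp
  qed
  define i0 :: 'p where "i0 = undefined"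
  define j0 :: 'q where "j0 = undefined"
  define s where "s = (\<Sum>i\<in>UNIV. x $ i)"
  \<comment> \<open>The stars at \<open>j0\<close> and \<open>i0\<close> produce \<open>x\<close>
    and \<open>y\<close>, but each also puts the total \<open>s\<close> on its centre; subtracting
    \<open>s\<close> times the edge \<open>(i0, j0)\<close> corrects both.\<close>
  let ?v = "(\<Sum>i\<in>UNIV. (x $ i) *\<^sub>R edge_vec (i, j0)) + (\<Sum>j\<in>UNIV. (y $ j) *\<^sub>R edge_vec (i0, j)) - s *\<^sub>R edge_vec (i0, j0)"
  have "?v \<in> ?W" by (intro span_diff span_add span_sum span_scale W)
  moreover have "?v = (x, y)"
  proof -
    have ax: "(\<Sum>i\<in>UNIV. (z $ i) *\<^sub>R axis i 1) = z" for z :: "real ^ 'k::finite"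
      using basis_expansion[of z] by (simp add: scalar_mult_eq_scaleR)
    have "fst ?v = x + (\<Sum>j\<in>UNIV. y $ j) *\<^sub>R axis i0 1 - s *\<^sub>R axis i0 1"
      by (simp add: fst_sum edge_vec_def ax scaleR_left.sum)
    moreover have "snd ?v = s *\<^sub>R axis j0 1 + y - s *\<^sub>R axis j0 1"
      by (simp add: snd_sum edge_vec_def ax scaleR_left.sum s_def)
    ultimately show ?thesis using xy by (simp add: prod_eq_iff s_def)
  qed
  ultimately have "(x, y) \<in> ?W" by simp
  then obtain u where u: "(x, y) = (\<Sum>v\<in>edge_vec ` T. u v *\<^sub>R v)"
    unfolding span_finite[OF finite_imageI[OF finite]] by (rule rangeE)
  have "(\<Sum>e\<in>T. u (edge_vec e) *\<^sub>R edge_vec e) = (x, y)"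
    unfolding u by (simp add: sum.reindex[OF inj_on_subset[OF inj_edge_vec subset_UNIV]])
  then show ?thesis by (rule exI[of _ "\<lambda>e. u (edge_vec e)"])
qed

section \<open>Unimodularity of spanning trees\<close>

lemma edge_vec_integer: "edge_vec e \<in> integer_points"
  by (auto simp: integer_points_def edge_vec_def Basis_prod_def Basis_vec_def inner_axis_axis)

lemma integer_points_fst:
  fixes z :: "(real ^ 'p::finite) \<times> (real ^ 'q::finite)"
  assumes z: "z \<in> integer_points"
  shows "fst z $ i \<in> \<int>"
proof -
  have "((axis i 1, 0) :: (real ^ 'p) \<times> (real ^ 'q)) \<in> Basis"
    by (auto simp: Basis_prod_def Basis_vec_def)
  then have "z \<bullet> (axis i 1, 0) \<in> \<int>" using z by (simp add: integer_points_def)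
  then show ?thesis by (simp add: inner_prod_def inner_axis)
qed

lemma integer_points_snd:
  fixes z :: "(real ^ 'p::finite) \<times> (real ^ 'q::finite)"
  assumes z: "z \<in> integer_points"
  shows "snd z $ j \<in> \<int>"
proof -
  have "((0, axis j 1) :: (real ^ 'p) \<times> (real ^ 'q)) \<in> Basis"
    by (auto simp: Basis_prod_def Basis_vec_def)
  then have "z \<bullet> (0, axis j 1) \<in> \<int>" using z by (simp add: integer_points_def)
  then show ?thesis by (simp add: inner_prod_def inner_axis)
qed

lemma affine_hull_root_polytope_sums:
  assumes "z \<in> affine hull (root_polytope H)"
  shows "(\<Sum>i\<in>UNIV. fst z $ i) = 1" "(\<Sum>j\<in>UNIV. snd z $ j) = 1"
proof -
  let ?A = "{z. (\<Sum>i\<in>UNIV. fst z $ i) = (1::real) \<and> (\<Sum>j\<in>UNIV. snd z $ j) = (1::real)}"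
  have "affine ?A"
    by (simp add: affine_def sum.distrib sum_distrib_left[symmetric])
  moreover have "edge_vec e \<in> ?A" for e by (simp add: edge_vec_def axis_def)
  then have "edge_vec ` H \<subseteq> ?A" by (intro image_subsetI)
  ultimately have "affine hull (root_polytope H) \<subseteq> ?A"
    unfolding root_polytope_eq affine_hull_convex_hull by (intro hull_minimal)
  then show "(\<Sum>i\<in>UNIV. fst z $ i) = 1" "(\<Sum>j\<in>UNIV. snd z $ j) = 1" using assms by auto
qed

lemma sum_edge_vec_image:
  "(\<Sum>x\<in>edge_vec ` T. f x) = (\<Sum>e\<in>T. f (edge_vec e))"
  by (simp add: sum.reindex[OF inj_on_subset[OF inj_edge_vec subset_UNIV]])

lemma spanning_edges_unimodular:
  fixes T :: "('p::finite \<times> 'q::finite) set"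
  assumes T: "independent (edge_vec ` T)" "card T + 1 = CARD('p) + CARD('q)"
    and z: "z \<in> affine hull (root_polytope H) \<inter> integer_points"
  shows "\<exists>u. sum u (edge_vec ` T) = 1 \<and> (\<forall>x\<in>edge_vec ` T. u x \<in> \<int>) \<and> (\<Sum>x\<in>edge_vec ` T. u x *\<^sub>R x) = z"
proof -
  obtain x y where xy: "z = (x, y)" by (cases z)
  have s: "(\<Sum>i\<in>UNIV. x $ i) = 1" "(\<Sum>j\<in>UNIV. y $ j) = 1"
    using affine_hull_root_polytope_sums[of z H] z xy by auto
  then obtain \<phi> where \<phi>: "(\<Sum>f\<in>T. \<phi> f *\<^sub>R edge_vec f) = (x, y)"
    using span_spanning_edges[OF T, of x y] by auto
  have int: "\<phi> e \<in> \<int>" if e: "e \<in> T" for e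
  proof -
    obtain A B where AB: "fst e \<in> A" "snd e \<notin> B" "\<And>f. f \<in> T \<Longrightarrow> f \<noteq> e \<Longrightarrow> fst f \<in> A \<longleftrightarrow> snd f \<in> B"
      using fundamental_cut[OF T(1) e] by blast
    have "\<phi> e = (\<Sum>k\<in>A. x $ k) - (\<Sum>l\<in>B. y $ l)" by (rule coefficient_eq_cut[OF e AB \<phi>])
    moreover have "x $ k \<in> \<int>" "y $ l \<in> \<int>" for k l
      using integer_points_fst[of z k] integer_points_snd[of z l] z xy by auto
    ultimately show ?thesis by (simp add: Ints_sum)
  qed
  have "sum \<phi> T = 1"
    using sum_fst_edge_vec[of \<phi> T UNIV] \<phi> s by simp
  then show ?thesis using \<phi> int
    by (intro exI[of _ "\<lambda>x. \<phi> (inv edge_vec x)"])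
       (simp add: sum_edge_vec_image inv_f_f[OF inj_edge_vec] xy)
qed

section \<open>Left degrees and flows on trees\<close>

definition left_degree :: "('p::finite \<times> 'q::finite) set \<Rightarrow> 'p \<Rightarrow> nat" where
  "left_degree T i = card {e \<in> T. fst e = i}"

lemma sum_left_degree:
  fixes T :: "('p::finite \<times> 'q::finite) set"
  shows "(\<Sum>i\<in>A. left_degree T i) = card {e \<in> T. fst e \<in> A}"
proof -
  have "(\<Sum>i\<in>A. left_degree T i) = card (\<Union>i\<in>A. {e \<in> T. fst e = i})"
    unfolding left_degree_def by (rule card_UN_disjoint[symmetric]) auto
  also have "(\<Union>i\<in>A. {e \<in> T. fst e = i}) = {e \<in> T. fst e \<in> A}" by auto
  finally show ?thesis .
qed

text \<open>
  The shift by \<open>1 / CARD('p)\<close> keeps the point away from the boundary of every cell: the flow it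
  induces on an edge of a spanning tree is never zero.
\<close>

definition degree_point :: "('p::finite \<Rightarrow> nat) \<Rightarrow> (real ^ 'p) \<times> (real ^ 'q::finite)" where
  "degree_point a = ((\<chi> i. real (a i) + 1 / real CARD('p)), (\<chi> j. 1))"

text \<open>For surjectivity: a cell that carries the distinguished point of \<open>a\<close> turns
  out to be full and to have the prescribed degrees.\<close>

lemma left_degree_of_flow:
  fixes T :: "('p::finite \<times> 'q::finite) set"
  assumes T: "independent (edge_vec ` T)" and pos: "\<And>e. e \<in> T \<Longrightarrow> 0 \<le> \<phi> e"
    and \<phi>: "(\<Sum>e\<in>T. \<phi> e *\<^sub>R edge_vec e) = degree_point a"
    and a: "sum a UNIV + 1 = CARD('q)"
  shows "left_degree T i = a i + 1" "card T + 1 = CARD('p) + CARD('q)"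
proof -
  \<comment> \<open>Every edge carries at most the unit demand of its right end, so vertex \<open>k\<close> with supply above
    \<open>a k\<close> has degree above \<open>a k\<close>; independence of \<open>T\<close> leaves no room for more.\<close>
  have le1: "\<phi> e \<le> 1" if e: "e \<in> T" for e
  proof -
    have "\<phi> e = (if snd e = snd e then \<phi> e else 0)" by simp
    also have "\<dots> \<le> (\<Sum>f\<in>T. if snd f \<in> {snd e} then \<phi> f else 0)"
      using member_le_sum[OF e, of "\<lambda>f. if snd f \<in> {snd e} then \<phi> f else 0"] pos by simp
    also have "\<dots> = 1"
      using sum_snd_edge_vec[of \<phi> T "{snd e}"] \<phi> by (simp add: degree_point_def)
    finally show ?thesis .
  qed
  have le: "a k + 1 \<le> left_degree T k" for k
  proof -
    have "real (a k) < real (a k) + 1 / real CARD('p)" by simp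
    also have "\<dots> = (\<Sum>f\<in>T. if fst f \<in> {k} then \<phi> f else 0)"
      using sum_fst_edge_vec[of \<phi> T "{k}"] \<phi> by (simp add: degree_point_def)
    also have "\<dots> \<le> (\<Sum>f\<in>T. if fst f = k then 1 else 0)"
      by (intro sum_mono) (use le1 in simp)
    also have "\<dots> = real (left_degree T k)"
      by (simp add: left_degree_def sum.inter_filter[symmetric])
    finally show ?thesis by simp
  qed
  have "(\<Sum>k\<in>UNIV. a k + 1) + 1 = CARD('p) + CARD('q)"
    using a by (simp add: sum_Suc)
  moreover have "card T + 1 \<le> CARD('p) + CARD('q)"
    by (rule card_independent_edges[OF T]) auto
  moreover have "(\<Sum>k\<in>UNIV. left_degree T k) = card T" by (simp add: sum_left_degree)
  moreover have "(\<Sum>k\<in>UNIV. a k + 1) \<le> (\<Sum>k\<in>UNIV. left_degree T k)" by (intro sum_mono le)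
  ultimately have eq: "(\<Sum>k\<in>UNIV. a k + 1) = (\<Sum>k\<in>UNIV. left_degree T k)"
    and "card T + 1 = CARD('p) + CARD('q)" by linarith+
  then show "card T + 1 = CARD('p) + CARD('q)" by blast
  show "left_degree T i = a i + 1"
    using sum_mono_inv[OF eq le, of i] by simp
qed

text \<open>For injectivity: a full cell contains the distinguished point of its own degree sequence
  in its relative interior.\<close>

lemma flow_of_left_degree:
  fixes T :: "('p::finite \<times> 'q::finite) set"
  assumes T: "independent (edge_vec ` T)" "card T + 1 = CARD('p) + CARD('q)"
    and deg: "\<And>i. left_degree T i = a i + 1"
  shows "\<exists>\<phi>. (\<forall>e\<in>T. 0 < \<phi> e) \<and> (\<Sum>e\<in>T. \<phi> e *\<^sub>R edge_vec e) = degree_point a"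
proof -
  let ?x = "(\<chi> i. real (a i) + 1 / real CARD('p)) :: real ^ 'p"
  let ?y = "(\<chi> j. 1) :: real ^ 'q"
  have "(\<Sum>i\<in>UNIV. a i + 1) = card T"
    using sum_left_degree[of T UNIV] deg by simp
  then have "sum a UNIV + 1 = CARD('q)" using T(2) by (simp add: sum_Suc)
  then have "real (sum a UNIV) + 1 = real CARD('q)" by linarith
  then have "(\<Sum>i\<in>UNIV. ?x $ i) = (\<Sum>j\<in>UNIV. ?y $ j)" by (simp add: sum.distrib)
  then obtain \<phi> where \<phi>: "(\<Sum>e\<in>T. \<phi> e *\<^sub>R edge_vec e) = (?x, ?y)"
    using span_spanning_edges[OF T] by blast
  have "0 < \<phi> e" if e: "e \<in> T" for e
  proof -
    obtain A B where AB: "fst e \<in> A" "snd e \<notin> B" "\<And>f. f \<in> T \<Longrightarrow> f \<noteq> e \<Longrightarrow> fst f \<in> A \<longleftrightarrow> snd f \<in> B"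
      using fundamental_cut[OF T(1) e] by blast
    have \<phi>e: "\<phi> e = (\<Sum>k\<in>A. ?x $ k) - (\<Sum>l\<in>B. ?y $ l)" by (rule coefficient_eq_cut[OF e AB \<phi>])
    \<comment> \<open>Both sides of the cut contain the maximal possible number of edges, so the supply of \<open>A\<close>
      exceeds the demand of \<open>B\<close> exactly by \<open>card A / CARD('p)\<close>.\<close>
    let ?I = "{f \<in> T. f \<noteq> e \<and> fst f \<in> A}" and ?O = "{f \<in> T. f \<noteq> e \<and> fst f \<notin> A}"
    have indep: "independent (edge_vec ` U)" if "U \<subseteq> T" for U
      using T(1) that by (meson image_mono independent_mono)
    have "card ?I + 1 \<le> card A + card B"
      by (rule card_independent_edges[OF indep]) (use AB in auto)
    moreover have "card ?O + 1 \<le> card (- A) + card (- B)"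
      by (rule card_independent_edges[OF indep]) (use AB in auto)
    moreover have "card ?I + card ?O + 1 = card T"
    proof -
      have "T = insert e (?I \<union> ?O)" using e by auto
      moreover have "card (insert e (?I \<union> ?O)) = card ?I + card ?O + 1"
        by (subst card_insert_disjoint) (auto intro!: card_Un_disjoint)
      ultimately show ?thesis by simp
    qed
    moreover have "card A + card (- A) = CARD('p)" "card B + card (- B) = CARD('q)"
      by (simp_all add: Compl_eq_Diff_UNIV card_Diff_subset card_mono)
    ultimately have "card ?I + 1 = card A + card B" using T(2) by linarith
    moreover have "{f \<in> T. fst f \<in> A} = insert e ?I" using e AB(1) by auto
    ultimately have "(\<Sum>i\<in>A. a i + 1) = card A + card B"
      using sum_left_degree[of T A] deg by simp
    then have "sum a A = card B" by (simp add: sum_Suc)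
    then have "real (sum a A) = real (card B)" by simp
    then have "\<phi> e = real (card A) / real CARD('p)" using \<phi>e by (simp add: sum.distrib)
    moreover have "card A > 0" using AB(1) by (auto simp: card_gt_0_iff)
    ultimately show ?thesis by simp
  qed
  then show ?thesis using \<phi> unfolding degree_point_def by blast
qed

text \<open>Flows and convex weights differ by a factor: each right vertex demands 1, so a flow has
  total \<open>CARD('q)\<close>.\<close>

lemma degree_point_in_rel_interior_iff:
  fixes T :: "('p::finite \<times> 'q::finite) set"
  assumes T: "independent (edge_vec ` T)"
  shows "(1 / real CARD('q)) *\<^sub>R degree_point a \<in> rel_interior (convex hull (edge_vec ` T)) \<longleftrightarrow>
    (\<exists>\<phi>. (\<forall>e\<in>T. 0 < \<phi> e) \<and> (\<Sum>e\<in>T. \<phi> e *\<^sub>R edge_vec e) = degree_point a)" (is "?c *\<^sub>R _ \<in> _ \<longleftrightarrow> ?R")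
proof -
  have "\<not> affine_dependent (edge_vec ` T)" using T by (simp add: affine_dependent_edge_vec_iff)
  then have "?c *\<^sub>R degree_point a \<in> rel_interior (convex hull (edge_vec ` T)) \<longleftrightarrow>
      (\<exists>u. (\<forall>x\<in>edge_vec ` T. 0 < u x) \<and> sum u (edge_vec ` T) = 1 \<and>
        (\<Sum>x\<in>edge_vec ` T. u x *\<^sub>R x) = ?c *\<^sub>R degree_point a)"
    by (simp add: rel_interior_convex_hull_explicit)
  also have "\<dots> \<longleftrightarrow> ?R"
  proof
    assume "\<exists>u. (\<forall>x\<in>edge_vec ` T. 0 < u x) \<and> sum u (edge_vec ` T) = 1 \<and>
        (\<Sum>x\<in>edge_vec ` T. u x *\<^sub>R x) = ?c *\<^sub>R degree_point a"
    then obtain u where u: "\<forall>x\<in>edge_vec ` T. 0 < u x"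
      "(\<Sum>x\<in>edge_vec ` T. u x *\<^sub>R x) = ?c *\<^sub>R degree_point a" by blast
    have "(\<Sum>e\<in>T. (real CARD('q) * u (edge_vec e)) *\<^sub>R edge_vec e) =
        real CARD('q) *\<^sub>R (\<Sum>x\<in>edge_vec ` T. u x *\<^sub>R x)"
      by (simp add: sum_edge_vec_image scaleR_right.sum)
    also have "\<dots> = degree_point a" using u(2) by simp
    finally show ?R using u(1) by (intro exI[of _ "\<lambda>e. real CARD('q) * u (edge_vec e)"]) simp
  next
    assume ?R
    then obtain \<phi> where \<phi>: "\<forall>e\<in>T. 0 < \<phi> e" "(\<Sum>e\<in>T. \<phi> e *\<^sub>R edge_vec e) = degree_point a" by blast
    let ?u = "\<lambda>x. ?c * \<phi> (inv edge_vec x)"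
    have "sum \<phi> T = real CARD('q)"
      using sum_snd_edge_vec[of \<phi> T UNIV] \<phi>(2) by (simp add: degree_point_def)
    then have "sum ?u (edge_vec ` T) = 1"
      by (simp add: sum_edge_vec_image inv_f_f[OF inj_edge_vec] sum_divide_distrib[symmetric])
    moreover have "(\<Sum>x\<in>edge_vec ` T. ?u x *\<^sub>R x) = ?c *\<^sub>R (\<Sum>e\<in>T. \<phi> e *\<^sub>R edge_vec e)"
      unfolding sum_edge_vec_image scaleR_right.sum by (simp add: inv_f_f[OF inj_edge_vec])
    moreover have "\<forall>x\<in>edge_vec ` T. 0 < ?u x" using \<phi>(1) by (simp add: inv_f_f[OF inj_edge_vec])
    ultimately show "\<exists>u. (\<forall>x\<in>edge_vec ` T. 0 < u x) \<and> sum u (edge_vec ` T) = 1 \<and>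
        (\<Sum>x\<in>edge_vec ` T. u x *\<^sub>R x) = ?c *\<^sub>R degree_point a"
      using \<phi>(2) by (intro exI[of _ ?u]) simp
  qed
  finally show ?thesis .
qed

section \<open>Full cells and draconian sequences\<close>

lemma degree_point_in_root_polytope:
  fixes G :: "('m::finite, 'n::finite) bigraph"
  assumes a: "a \<in> draconian G" and a': "\<And>i. a' (Some i) = a i" "a' None = CARD('n) - sum a UNIV"
  shows "(1 / real CARD('n option)) *\<^sub>R degree_point a' \<in> root_polytope (augmented G)"
proof -
  have "(\<Sum>i\<in>J. a i) \<le> card ((\<Union>i\<in>J. nbrs G i) \<inter> UNIV)" for J
    using a by (cases "J = {}") (auto simp: draconian_def)
  from draconian_assignment[OF finite this]
  obtain \<sigma> :: "'n \<Rightarrow> 'm option" where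
    \<sigma>: "\<And>j i. \<sigma> j = Some i \<Longrightarrow> (i, j) \<in> G" "\<And>i. card {j. \<sigma> j = Some i} = a i" by blast
  have "card {j. \<sigma> j = i} = a' i" for i
  proof (cases i)
    case None
    have "CARD('n) = card (\<Union>i\<in>UNIV. {j. \<sigma> j = i})" by (rule arg_cong[where f = card]) auto
    also have "\<dots> = (\<Sum>i\<in>UNIV. card {j. \<sigma> j = i})" by (rule card_UN_disjoint) auto
    also have "\<dots> = card {j. \<sigma> j = None} + sum a UNIV"
      by (simp add: UNIV_option_conv sum.reindex \<sigma>(2))
    finally show ?thesis using None a' by simp
  qed (simp add: a' \<sigma>(2))
  note deg = this
  let ?p = "real CARD('m option)"
  \<comment> \<open>A right vertex of \<open>G\<close> draws one unit from the left vertex given by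
    \<open>\<sigma>\<close>, where \<open>None\<close> means both unassigned and the added left
    vertex. The added right vertex draws the surplus \<open>1 / ?p\<close> from every left
    vertex.\<close>
  let ?\<phi> = "\<lambda>e. case snd e of Some j \<Rightarrow> (if \<sigma> j = fst e then 1 else 0) | None \<Rightarrow> 1 / ?p"
  let ?T = "augmented G"
  \<comment> \<open>The flow vanishes off the graph, so the sums may run over all pairs and be split
    by coordinates.\<close>
  have out: "?\<phi> e = 0" if "e \<notin> ?T" for e
    using that \<sigma>(1) by (cases e; cases "fst e"; cases "snd e") (auto simp: augmented_def)
  have ext: "(\<Sum>e\<in>?T. if P e then ?\<phi> e else 0) = (\<Sum>e\<in>UNIV. if P e then ?\<phi> e else 0)" for P
    by (rule sum.mono_neutral_left) (use out in \<open>auto split: if_splits\<close>)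
  have iter: "(\<Sum>e\<in>UNIV. F e) = (\<Sum>i\<in>UNIV. (\<Sum>j\<in>UNIV. F (i, Some j)) + F (i, None))"
    for F :: "'m option \<times> 'n option \<Rightarrow> real"
  proof -
    have "(\<Sum>j\<in>UNIV. F (i, Some j)) + F (i, None) = (\<Sum>j\<in>UNIV. F (i, j))" for i
      by (simp add: UNIV_option_conv[where ?'a = 'n] sum.reindex)
    then show ?thesis by (simp add: sum.cartesian_product)
  qed
  have flow: "(\<Sum>e\<in>?T. ?\<phi> e *\<^sub>R edge_vec e) = degree_point a'"
    unfolding degree_point_def
  proof (rule sum_edge_vec_eqI)
    fix i
    have "(\<Sum>e\<in>?T. if fst e = i then ?\<phi> e else 0) =
        (\<Sum>k\<in>UNIV. if k = i then (\<Sum>j\<in>UNIV. if \<sigma> j = i then 1 else 0) + 1 / ?p else 0)"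
      unfolding ext iter by (intro sum.cong) auto
    also have "\<dots> = real (card {j. \<sigma> j = i}) + 1 / ?p"
      by (simp add: sum.inter_filter[symmetric])
    finally show "(\<Sum>e\<in>?T. if fst e = i then ?\<phi> e else 0) = (\<chi> i. real (a' i) + 1 / ?p) $ i"
      by (simp add: deg)
  next
    fix j
    have "(\<Sum>e\<in>?T. if snd e = j then ?\<phi> e else 0) = 1"
    proof (cases j)
      case None
      then show ?thesis unfolding ext iter by simp
    next
      case (Some l)
      then have "(\<Sum>e\<in>?T. if snd e = j then ?\<phi> e else 0) =
          (\<Sum>i\<in>UNIV. \<Sum>k\<in>UNIV. if k = l then (if \<sigma> l = i then 1 else 0) else 0)"
        unfolding ext iter by (intro sum.cong) (auto intro!: sum.cong)
      then show ?thesis by simp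
    qed
    then show "(\<Sum>e\<in>?T. if snd e = j then ?\<phi> e else 0) = (\<chi> j. 1) $ j" by simp
  qed
  have "sum ?\<phi> ?T = real CARD('n option)"
    using sum_snd_edge_vec[of ?\<phi> ?T UNIV] unfolding flow by (simp add: degree_point_def)
  then have one: "(\<Sum>e\<in>?T. ?\<phi> e / real CARD('n option)) = 1"
    by (simp add: sum_divide_distrib[symmetric])
  have "(\<Sum>e\<in>?T. (?\<phi> e / real CARD('n option)) *\<^sub>R edge_vec e) \<in> root_polytope ?T"
    unfolding root_polytope_eq
    by (rule convex_sum[OF finite convex_convex_hull one]) (auto intro: hull_inc split: option.split)
  also have "(\<Sum>e\<in>?T. (?\<phi> e / real CARD('n option)) *\<^sub>R edge_vec e) =
      (1 / real CARD('n option)) *\<^sub>R (\<Sum>e\<in>?T. ?\<phi> e *\<^sub>R edge_vec e)"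
    unfolding scaleR_right.sum by (intro sum.cong refl) simp
  finally show ?thesis unfolding flow .
qed

text \<open>Edges of \<open>T\<close> at \<open>J\<close> end in neighbours of \<open>J\<close> or
  in the added right vertex. This one extra vertex offsets the 1 in the forest bound. The degree of
  the added left vertex follows from the total number of edges.\<close>

lemma draconian_left_degree:
  fixes G :: "('m::finite, 'n::finite) bigraph"
  assumes T: "independent (edge_vec ` T)" "T \<subseteq> augmented G" "card T + 1 = CARD('m option) + CARD('n option)"
  defines "a \<equiv> \<lambda>i. left_degree T (Some i) - 1"
  shows "a \<in> draconian G" "left_degree T (Some i) = a i + 1" "left_degree T None = CARD('n) - sum a UNIV + 1"
proof -
  \<comment> \<open>Without edges at \<open>i\<close> the forest \<open>T\<close> would live on one
    vertex fewer and be too large. Hence the natural subtraction in \<open>a\<close> is exact, and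
    at \<open>None\<close> positivity gives \<open>sum a UNIV \<le> CARD('n)\<close>.\<close>
  have pos: "left_degree T i \<noteq> 0" for i
  proof
    assume "left_degree T i = 0"
    then have "T \<subseteq> (- {i}) \<times> UNIV" by (auto simp: left_degree_def)
    then have "card T + 1 \<le> card (- {i}) + CARD('n option)"
      by (rule card_independent_edges[OF T(1)]) simp
    then show False using T(3) by (simp add: Compl_eq_Diff_UNIV)
  qed
  then show deg: "left_degree T (Some i) = a i + 1" for i by (simp add: a_def)
  have "(\<Sum>i\<in>J. a i) \<le> card (\<Union>i\<in>J. nbrs G i)" if J: "J \<noteq> {}" for J
  proof -
    let ?U = "{e \<in> T. fst e \<in> Some ` J}"
    have "independent (edge_vec ` ?U)" using T(1) by (rule independent_mono) auto
    moreover have "?U \<subseteq> (Some ` J) \<times> insert None (Some ` (\<Union>i\<in>J. nbrs G i))"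
    proof
      fix e assume e: "e \<in> ?U"
      then have "e \<in> augmented G" "fst e \<in> Some ` J" using T(2) by auto
      then show "e \<in> (Some ` J) \<times> insert None (Some ` (\<Union>i\<in>J. nbrs G i))"
        by (cases e) (auto simp: augmented_def nbrs_def)
    qed
    ultimately have "card ?U + 1 \<le> card (Some ` J) + card (insert None (Some ` (\<Union>i\<in>J. nbrs G i)))"
      by (rule card_independent_edges) simp
    then have "card ?U \<le> card J + card (\<Union>i\<in>J. nbrs G i)"
      by (simp add: card_image)
    moreover have "card ?U = (\<Sum>i\<in>J. a i + 1)"
      by (simp add: sum_left_degree[symmetric] sum.reindex deg)
    ultimately show ?thesis by (simp add: sum_Suc)
  qed
  then show "a \<in> draconian G" by (simp add: draconian_def)
  have "card T = left_degree T None + (\<Sum>i\<in>UNIV. a i + 1)"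
  proof -
    have "card T = (\<Sum>i\<in>UNIV. left_degree T i)" by (simp add: sum_left_degree)
    then show ?thesis by (simp add: UNIV_option_conv sum.reindex deg)
  qed
  then have "left_degree T None + sum a UNIV = CARD('n) + 1"
    using T(3) by (simp add: sum_Suc)
  moreover have "left_degree T None \<noteq> 0" by (rule pos)
  ultimately show "left_degree T None = CARD('n) - sum a UNIV + 1" by linarith
qed

text \<open>The sum type \<open>'m + 'n\<close> stands for the dimension: the augmented graph has m
  + n + 2 vertices, so its spanning trees have \<open>Suc CARD('m + 'n)\<close> edges.\<close>

lemma card_full_cells:
  fixes G :: "('m::finite, 'n::finite) bigraph"
  assumes \<T>: "\<And>S. S \<in> \<T> \<Longrightarrow> S \<subseteq> edge_vec ` augmented G" "\<And>S. S \<in> \<T> \<Longrightarrow> \<not> affine_dependent S"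
      "\<And>q. q \<in> root_polytope (augmented G) \<Longrightarrow> \<exists>!S. S \<in> \<T> \<and> q \<in> rel_interior (convex hull S)"
  shows "card {S \<in> \<T>. card S = Suc CARD('m + 'n)} = card (draconian G)"
proof -
  define edges where "edges S = edge_vec -` S" for S :: "((real ^ 'm option) \<times> (real ^ 'n option)) set"
  define ext where "ext a i = (case i of Some k \<Rightarrow> a k | None \<Rightarrow> CARD('n) - sum a UNIV)" for a :: "'m \<Rightarrow> nat" and i
  define \<Phi> where "\<Phi> S i = left_degree (edges S) (Some i) - 1" for S i
  define pt where "pt a = (1 / real CARD('n option)) *\<^sub>R
    (degree_point (ext a) :: (real ^ 'm option) \<times> (real ^ 'n option))" for a
  have edges: "S = edge_vec ` edges S" "edges S \<subseteq> augmented G" "independent (edge_vec ` edges S)"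
    "card (edges S) = card S" if S: "S \<in> \<T>" for S
  proof -
    show 1: "S = edge_vec ` edges S" using \<T>(1)[OF S] by (auto simp: edges_def)
    show "edges S \<subseteq> augmented G"
      using vimage_mono[OF \<T>(1)[OF S], of edge_vec]
      by (simp only: edges_def inj_vimage_image_eq[OF inj_edge_vec])
    show "independent (edge_vec ` edges S)"
      using \<T>(2)[OF S] affine_dependent_edge_vec_iff[of "edges S"] 1 by simp
    show "card (edges S) = card S"
      using 1 card_image[OF inj_on_subset[OF inj_edge_vec subset_UNIV], of "edges S"] by simp
  qed
  let ?F = "{S \<in> \<T>. card S = Suc CARD('m + 'n)}"
  have full: "card (edges S) + 1 = CARD('m option) + CARD('n option)" if "S \<in> ?F" for S
    using that edges(4)[of S] by simp
  have deg: "\<Phi> S \<in> draconian G" "left_degree (edges S) i = ext (\<Phi> S) i + 1" if S: "S \<in> ?F" for S i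
  proof -
    have ST: "S \<in> \<T>" using S by simp
    note d = draconian_left_degree[OF edges(3,2)[OF ST] full[OF S]]
    have \<Phi>: "\<Phi> S = (\<lambda>i. left_degree (edges S) (Some i) - 1)" by (auto simp: \<Phi>_def)
    show "\<Phi> S \<in> draconian G" unfolding \<Phi> by (rule d(1))
    show "left_degree (edges S) i = ext (\<Phi> S) i + 1"
    proof (cases i)
      case None
      show ?thesis unfolding None ext_def option.case \<Phi> by (rule d(3))
    next
      case (Some k)
      show ?thesis unfolding Some ext_def option.case \<Phi> by (rule d(2))
    qed
  qed
  have cell: "pt (\<Phi> S) \<in> rel_interior (convex hull S)" if S: "S \<in> ?F" for S
  proof -
    have ST: "S \<in> \<T>" using S by simp
    have "pt (\<Phi> S) \<in> rel_interior (convex hull (edge_vec ` edges S))"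
      unfolding pt_def degree_point_in_rel_interior_iff[OF edges(3)[OF ST]]
      by (rule flow_of_left_degree[OF edges(3)[OF ST] full[OF S]]) (rule deg(2)[OF S])
    then show ?thesis using edges(1)[OF ST] by simp
  qed
  have pt: "pt a \<in> root_polytope (augmented G)" if "a \<in> draconian G" for a
    unfolding pt_def by (rule degree_point_in_root_polytope[OF that]) (simp_all add: ext_def)
  have "inj_on \<Phi> ?F"
  proof (rule inj_onI)
    fix S S' assume S: "S \<in> ?F" "S' \<in> ?F" "\<Phi> S = \<Phi> S'"
    note ex1 = \<T>(3)[OF pt[OF deg(1)[OF S(1)]]]
    have 1: "S \<in> \<T> \<and> pt (\<Phi> S) \<in> rel_interior (convex hull S)"
      using cell[OF S(1)] S(1) by simp
    have 2: "S' \<in> \<T> \<and> pt (\<Phi> S) \<in> rel_interior (convex hull S')"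
      using cell[OF S(2)] S(2,3) by simp
    show "S = S'"
      by (rule trans[OF the1_equality[OF ex1 1, symmetric] the1_equality[OF ex1 2]])
  qed
  moreover have "\<Phi> ` ?F = draconian G"
  proof (intro equalityI subsetI)
    fix a assume a: "a \<in> draconian G"
    \<comment> \<open>This cell is not known to be full; the degree count below shows that it
      is.\<close>
    obtain S where S: "S \<in> \<T>" "pt a \<in> rel_interior (convex hull S)"
      using ex1_implies_ex[OF \<T>(3)[OF pt[OF a]]] by auto
    have "pt a \<in> rel_interior (convex hull (edge_vec ` edges S))"
      unfolding edges(1)[OF S(1), symmetric] by (rule S(2))
    then obtain \<phi> where \<phi>: "\<forall>e\<in>edges S. 0 < \<phi> e"
      "(\<Sum>e\<in>edges S. \<phi> e *\<^sub>R edge_vec e) = degree_point (ext a)"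
      unfolding pt_def degree_point_in_rel_interior_iff[OF edges(3)[OF S(1)]] by auto
    \<comment> \<open>The draconian bound for the set of all left vertices makes the subtraction in
      \<open>ext\<close> exact, so \<open>ext a\<close> has total \<open>CARD('n)\<close>.\<close>
    have "sum a UNIV \<le> card (\<Union>i\<in>UNIV. nbrs G i)" using a unfolding draconian_def by blast
    also have "\<dots> \<le> CARD('n)" by (rule card_mono) auto
    finally have "sum (ext a) UNIV + 1 = CARD('n option)"
      by (simp add: UNIV_option_conv sum.reindex ext_def card_image)
    note d = left_degree_of_flow[OF edges(3)[OF S(1)] less_imp_le[OF \<phi>(1)[rule_format]] \<phi>(2) this]
    have "S \<in> ?F" using S d(2) edges(4)[OF S(1)] by simp
    moreover have "\<Phi> S = a" by (rule ext) (simp add: \<Phi>_def d(1) ext_def)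
    ultimately show "a \<in> \<Phi> ` ?F" by (intro image_eqI[of _ _ S]) simp_all
  next
    fix a assume "a \<in> \<Phi> ` ?F"
    then obtain S where S: "S \<in> ?F" "a = \<Phi> S" by (rule imageE)
    show "a \<in> draconian G" unfolding S(2) by (rule deg(1)[OF S(1)])
  qed
  ultimately have "bij_betw \<Phi> ?F (draconian G)" by (rule bij_betw_imageI)
  then show ?thesis by (rule bij_betw_same_card)
qed

section \<open>Dimension and volume of the root polytope\<close>

lemma lattice_volume_root_polytope:
  fixes G :: "('m::finite, 'n::finite) bigraph"
  defines "P \<equiv> root_polytope (augmented G)"
  shows "aff_dim P = int CARD('m + 'n)"
    and "lattice_volume P = real (card (draconian G)) / fact CARD('m + 'n)"
proof -
  let ?V = "edge_vec ` augmented G" and ?d = "CARD('m + 'n)"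
  have PV: "P = convex hull ?V" by (simp only: P_def root_polytope_eq)
  obtain \<T> where \<T>: "\<And>S. S \<in> \<T> \<Longrightarrow> S \<subseteq> ?V" "\<And>S. S \<in> \<T> \<Longrightarrow> \<not> affine_dependent S"
    "\<And>q. q \<in> P \<Longrightarrow> \<exists>!S. S \<in> \<T> \<and> q \<in> rel_interior (convex hull S)"
    using regular_triangulation[of ?V] unfolding PV by auto
  have count: "card {S \<in> \<T>. card S = Suc ?d} = card (draconian G)"
    using \<T> unfolding P_def by (rule card_full_cells)
  \<comment> \<open>The zero sequence guarantees a full cell \<open>S0\<close>, which yields both
    the lower bound on the dimension and a lattice frame.\<close>
  have "(\<lambda>_. 0) \<in> draconian G" by (simp add: draconian_def)
  then have "card (draconian G) > 0" using finite_draconian card_gt_0_iff by blast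
  then have "{S \<in> \<T>. card S = Suc ?d} \<noteq> {}" unfolding count[symmetric] by (auto simp: card_gt_0_iff)
  then obtain S0 where S0: "S0 \<in> \<T>" "card S0 = Suc ?d" by blast
  show dim: "aff_dim P = int ?d"
  proof (rule antisym)
    have "S0 \<subseteq> P" using \<T>(1)[OF S0(1)] hull_subset[of ?V convex] unfolding PV by (rule order_trans)
    then have "aff_dim S0 \<le> aff_dim P" by (rule aff_dim_subset)
    then show "int ?d \<le> aff_dim P" using aff_dim_affine_independent[OF \<T>(2)[OF S0(1)]] S0(2) by simp
    \<comment> \<open>For the upper bound, an affine basis chosen among the vertices is a forest, to
      which the forest bound applies.\<close>
    obtain B where B: "\<not> affine_dependent B" "B \<subseteq> ?V" "affine hull ?V = affine hull B"
      using affine_basis_exists[of ?V] by blast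
    then obtain T where T: "B = edge_vec ` T" by (meson subset_imageE)
    have "card T + 1 \<le> CARD('m option) + CARD('n option)"
      using B(1) by (intro card_independent_edges) (auto simp: T affine_dependent_edge_vec_iff)
    moreover have "card B \<le> card T" unfolding T by (rule card_image_le) simp
    moreover have "aff_dim P = aff_dim B"
      using B(3) by (metis PV aff_dim_affine_hull affine_hull_convex_hull)
    ultimately show "aff_dim P \<le> int ?d" using aff_dim_affine_independent[OF B(1)] by simp
  qed
  have uni: "\<exists>u. sum u S = 1 \<and> (\<forall>x\<in>S. u x \<in> \<int>) \<and> (\<Sum>x\<in>S. u x *\<^sub>R x) = y"
    if S: "S \<in> \<T>" "card S = Suc ?d" and y: "y \<in> affine hull P \<inter> integer_points" for S y
  proof -
    obtain T where T: "S = edge_vec ` T" using \<T>(1)[OF S(1)] by (meson subset_imageE)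
    have "card T = card S" unfolding T by (rule card_image[OF inj_on_subset[OF inj_edge_vec subset_UNIV], symmetric])
    then have "card T + 1 = CARD('m option) + CARD('n option)" using S(2) by simp
    moreover have "independent (edge_vec ` T)" using \<T>(2)[OF S(1)] by (simp add: T affine_dependent_edge_vec_iff)
    ultimately show ?thesis using spanning_edges_unimodular y unfolding T P_def by blast
  qed
  have Vint: "?V \<subseteq> integer_points" using edge_vec_integer by blast
  have vol: "measure (\<Pi>\<^sub>M i\<in>{..<?d}. lborel) {t \<in> Pi\<^sub>E {..<?d} (\<lambda>_. UNIV). p + (\<Sum>i<?d. t i *\<^sub>R b i) \<in> P}
      = real (card (draconian G)) / fact ?d" if "lattice_frame P p b" for p b
    using measure_lattice_frame[OF _ Vint PV dim \<T> uni that] count by simp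
  have "\<exists>p b. lattice_frame P p b"
  proof (rule lattice_frame_exists)
    show "finite S0" using S0(2) by (simp add: card_ge_0_finite)
    show "\<not> affine_dependent S0" by (rule \<T>(2)[OF S0(1)])
    have "?V \<subseteq> affine hull P" unfolding PV affine_hull_convex_hull by (rule hull_subset)
    then show "S0 \<subseteq> affine hull P \<inter> integer_points" using \<T>(1)[OF S0(1)] Vint by blast
    show "card S0 = Suc (nat (aff_dim P))" using S0(2) dim by simp
  qed (rule uni[OF S0])
  then obtain p b where frame: "lattice_frame P p b" by (elim exE)
  show "lattice_volume P = real (card (draconian G)) / fact ?d"
    unfolding lattice_volume_def Let_def dim nat_int
  proof (rule the_equality)
    show "\<exists>p b. lattice_frame P p b \<and> real (card (draconian G)) / fact ?d =
        measure (\<Pi>\<^sub>M i\<in>{..<?d}. lborel) {t \<in> Pi\<^sub>E {..<?d} (\<lambda>_. UNIV). p + (\<Sum>i<?d. t i *\<^sub>R b i) \<in> P}"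
      by (intro exI[of _ p] exI[of _ b] conjI frame vol[OF frame, symmetric])
  qed (elim exE conjE, simp only: vol)
qed

theorem corollary4p4:
  fixes G :: "('m::finite, 'n::finite) bigraph"
  shows "normalized_volume (root_polytope (augmented G)) = real_of_int (poly (draconian_poly G) 1) \<and>
         poly (draconian_poly G) 1 = int (card (draconian G))"
proof -
  have "poly (draconian_poly G) 1 = int (card (draconian G))"
    by (simp add: draconian_poly_def poly_sum poly_monom)
  moreover have "normalized_volume (root_polytope (augmented G)) = real (card (draconian G))"
    unfolding normalized_volume_def lattice_volume_root_polytope nat_int by simp
  ultimately show ?thesis by simp
qed

end
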